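(* Let $\mathcal{Q}=\mathcal{S}_+^n$, let $\mathcal{D}=\{X\in\mathcal{S}_+^n:\ \operatorname{rank}(X)\le k,\ f(\lambda(X))\le 0\}$, and let $\tilde k\le k$ be its strengthened rank. Consider $$V_{\rm rel}:=\min_{X\in \operatorname{conv}(\mathcal{D})}\{\langle A_0,X\rangle:\ b_i^l\le\langle A_i,X\rangle\le b_i^u,\ \forall i\in[m]\}\qquad\text{(LSOP-R)},$$ and let $\tilde m$ be the number of linearly independent matrices among $A_1,\dots,A_m$. Then: (i) every extreme point of the feasible set of LSOP-R has rank at most $\tilde k+\lfloor\sqrt{2\tilde m+9/4}-3/2\rfloor$; and (ii) there is an optimal solution to LSOP-R of rank at most $\tilde k+\lfloor\sqrt{2\tilde m+9/4}-3/2\rfloor$ if LSOP-R yields a finite optimal value, i.e., $V_{\rm rel}>-\infty$.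
   Context: $k\le n$ are positive integers; $[m]=\{1,\dots,m\}$; $\mathcal{S}_+^n$ is the set of $n\times n$ real symmetric positive semidefinite matrices; $\langle\cdot,\cdot\rangle$ is the Frobenius inner product; $\operatorname{conv}$ denotes convex hull. $\lambda(X)\in\mathbb{R}^n$ is the vector of eigenvalues of $X$. The function $f:\mathbb{R}^n\to\mathbb{R}$ is continuous, convex and symmetric (invariant under permutations of its arguments), so that $F(X):=f(\lambda(X))$ is a continuous convex spectral function. $A_0,A_1,\dots,A_m$ are real symmetric $n\times n$ matrices and $-\infty\le b_i^l\le b_i^u\le+\infty$. The number $\tilde m$ is the dimension of the linear span of $\{A_i\}_{i\in[m]}$. Strengthened rank: $\tilde k$ with $1\le\tilde k\le k$ is the smallest integer such that $\operatorname{conv}(\mathcal{D})=\operatorname{conv}(\{X\in\mathcal{S}_+^n:\ \operatorname{rank}(X)\le\tilde k,\ f(\lambda(X))\le0\})$.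
   Formalization: In (ii) the finite optimal value is assumed to be attained and LSOP-R feasible (V_rel < +∞); with V_rel merely a finite infimum it fails, e.g. n=k=2, f(x,y)=sqrt((x-y)²+4)-(x+y), minimizing X_11 without active constraints. *)

theory Defs
  imports "HOL-Analysis.Analysis"
begin

text \<open>
  Matrices of size \<open>n \<times> n\<close> have type \<^typ>\<open>real^'n^'n\<close> with \<open>n = CARD('n)\<close>; on this type the inner
  product \<^term>\<open>A \<bullet> B\<close> is the sum of the products of the entries, that is, the Frobenius inner product.
\<close>

definition symmetric_mat :: "real^'n^'n \<Rightarrow> bool" where
  "symmetric_mat X \<longleftrightarrow> transpose X = X"

definition psd :: "(real^'n^'n) set" where
  "psd = {X. symmetric_mat X \<and> (\<forall>v. 0 \<le> v \<bullet> (X *v v))}"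

text \<open>
  The entries of \<open>l\<close> are the eigenvalues of \<open>X\<close> with algebraic multiplicity: the characteristic
  polynomial of \<open>X\<close> splits as the product of \<open>t - l $ i\<close>.
  For a symmetric \<open>X\<close> such an \<open>l\<close> exists and is unique up to the order of its entries. The order
  is left unspecified in \<open>eigenvalues\<close>, which is only used inside symmetric functions.
\<close>

definition eigenvalue_vector :: "real^'n^'n \<Rightarrow> real^'n \<Rightarrow> bool" where
  "eigenvalue_vector X l \<longleftrightarrow> (\<forall>t. det (mat t - X) = (\<Prod>i\<in>UNIV. t - l $ i))"

definition eigenvalues :: "real^'n^'n \<Rightarrow> real^'n" where
  "eigenvalues X = (SOME l. eigenvalue_vector X l)"

definition symmetric_fun :: "(real^'n \<Rightarrow> real) \<Rightarrow> bool" where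
  "symmetric_fun f \<longleftrightarrow> (\<forall>p x. p permutes UNIV \<longrightarrow> f (\<chi> i. x $ p i) = f x)"

definition domain_set :: "(real^'n \<Rightarrow> real) \<Rightarrow> nat \<Rightarrow> (real^'n^'n) set" where
  "domain_set f k = {X \<in> psd. rank X \<le> k \<and> f (eigenvalues X) \<le> 0}"

definition strengthened_rank :: "(real^'n \<Rightarrow> real) \<Rightarrow> nat \<Rightarrow> nat" where
  "strengthened_rank f k =
     (LEAST j. 1 \<le> j \<and> j \<le> k \<and> convex hull (domain_set f k) = convex hull (domain_set f j))"

definition lsop_r_feasible ::
  "(real^'n \<Rightarrow> real) \<Rightarrow> nat \<Rightarrow> nat \<Rightarrow> (nat \<Rightarrow> real^'n^'n) \<Rightarrow> (nat \<Rightarrow> ereal) \<Rightarrow> (nat \<Rightarrow> ereal)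
     \<Rightarrow> (real^'n^'n) set" where
  "lsop_r_feasible f k m A bl bu =
     {X \<in> convex hull (domain_set f k).
        \<forall>i\<in>{1..m}. bl i \<le> ereal (A i \<bullet> X) \<and> ereal (A i \<bullet> X) \<le> bu i}"

text \<open>
  \<open>V\<close> is the value of the minimization problem of \<open>g\<close> over \<open>S\<close>. It is \<open>\<infinity>\<close> if \<open>S\<close> is empty and
  \<open>-\<infinity>\<close> if \<open>g\<close> is unbounded below; a finite value is a minimum in the strict sense, that is, it is
  attained. A finite infimum that is not attained is not the value of a minimization problem:
  for \<open>n = k = 2\<close> and \<open>f (x, y) = sqrt ((x - y)\<^sup>2 + 4) - (x + y)\<close> the feasible set without further
  constraints consists of the positive semidefinite matrices of determinant at least 1, on which the
  infimum 0 of the entry \<open>X $ 1 $ 1\<close> is not attained, so no optimal solution exists.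
\<close>

definition is_min_value :: "('a \<Rightarrow> real) \<Rightarrow> 'a set \<Rightarrow> ereal \<Rightarrow> bool" where
  "is_min_value g S V \<longleftrightarrow>
     V = (INF X\<in>S. ereal (g X)) \<and> (\<bar>V\<bar> \<noteq> \<infinity> \<longrightarrow> (\<exists>X\<in>S. ereal (g X) = V))"

definition optimal_solution :: "('a \<Rightarrow> real) \<Rightarrow> 'a set \<Rightarrow> 'a \<Rightarrow> bool" where
  "optimal_solution g S X \<longleftrightarrow> X \<in> S \<and> (\<forall>Y\<in>S. g X \<le> g Y)"

end

theory Submission
  imports Defs "HOL-Combinatorics.Permutations" "HOL-Computational_Algebra.Polynomial"
begin

text \<open>
  Write \<open>kt\<close> for the strengthened rank, so that \<open>conv D\<close> is the hull of the matrices of rank at most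
  \<open>kt\<close> in \<open>D\<close>. The proof rests on a description of this hull by majorization (\<open>convex_hull_domain_set\<close>):
  a symmetric matrix \<open>Y\<close> lies in it iff some nonnegative decreasing vector \<open>x\<close> with at most \<open>kt\<close> nonzero
  entries and \<open>f x \<le> 0\<close> majorizes the spectrum of \<open>Y\<close>. Majorization is phrased without eigenvalues,
  in the manner of Ky Fan: in every orthonormal basis the sum of \<open>j\<close> diagonal entries of \<open>Y\<close> is at most
  the sum of the \<open>j\<close> largest entries of \<open>x\<close>, and the traces agree. These are linear conditions on
  \<open>(Y, x)\<close>, so together with convexity of \<open>f\<close> they define a convex set; the converse inclusion separates
  \<open>Y\<close> from the compact hull of the orbit of \<open>x\<close> under conjugation and refutes the separation by
  summation by parts.

  Let \<open>X\<close> be in the hull, with decreasing eigenvalues \<open>l\<close>, eigenvectors \<open>u\<^sub>0, u\<^sub>1, \<dots>\<close>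
  and rank \<open>r = kt + q\<close> with \<open>q > 0\<close>. Then \<open>X\<close> can be moved in both directions along every traceless
  symmetric \<open>\<Delta>\<close> that lives on the \<open>q + 1\<close> eigenvectors \<open>u\<^sub>i\<close> with \<open>kt - 1 \<le> i < r\<close>
  (\<open>eventually_perturbed_in_majorized_set\<close>). Indeed the majorization inequality of index \<open>j\<close> is strict
  for \<open>kt \<le> j < r\<close>, because \<open>x\<close> has already spent its whole sum on \<open>kt\<close> entries while \<open>l\<close> has not.
  If it is tight for some \<open>0 < j < kt\<close>, then \<open>l\<close> must drop strictly between the indices \<open>j - 1\<close> and
  \<open>kt - 1\<close> (\<open>tight_partial_sum_gap\<close>), and a small change of the lower block leaves the \<open>j\<close> largest
  eigenvalues alone. For \<open>j \<ge> r\<close> the inequality is a consequence of positive semidefiniteness and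
  the fixed trace.

  Without the trace condition these \<open>\<Delta>\<close> form a space of dimension \<open>(q + 1) (q + 2) / 2\<close>. If this
  exceeds \<open>mt + 1\<close>, some nonzero \<open>\<Delta>\<close> is orthogonal to the identity and to all constraint matrices
  (\<open>two_sided_perturbation\<close>), and then \<open>X\<close> is not an extreme point of the feasible set. The inequality
  \<open>(q + 1) (q + 2) \<le> 2 (mt + 1)\<close> is the bound \<open>q \<le> sqrt (2 mt + 9/4) - 3/2\<close>, which proves the
  first claim. For the second claim, fix an optimal \<open>X\<^sub>0\<close> and consider the optimal solutions with
  the trace of \<open>X\<^sub>0\<close>. They form a compact convex set, which has an extreme point; the direction
  \<open>\<Delta>\<close> is traceless, and optimality at \<open>X\<close> forces it to be orthogonal to the objective, so that no
  further constraint has to be counted and the same bound holds.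
\<close>

section \<open>Quadratic forms and orthonormal bases\<close>

definition outer :: "real^'n \<Rightarrow> real^'n \<Rightarrow> real^'n^'n" where
  "outer u v = (\<chi> i j. u $ i * v $ j)"

lemma outer_mult_vec: "outer u v *v w = (v \<bullet> w) *\<^sub>R u"
  by (simp add: outer_def matrix_vector_mult_def vec_eq_iff inner_vec_def sum_distrib_left
      sum_distrib_right mult_ac)

lemma inner_outer: "X \<bullet> outer u v = u \<bullet> (X *v v)"
  by (simp add: outer_def inner_vec_def matrix_vector_mult_def sum_distrib_left mult_ac)

lemma inner_outer_outer: "outer a b \<bullet> outer c d = (a \<bullet> c) * (b \<bullet> d)"
  by (simp add: inner_outer outer_mult_vec inner_commute)

lemma trace_inner: "trace X = X \<bullet> (mat 1 :: real^'n^'n)"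
proof -
  have "(\<Sum>j\<in>UNIV. X $ i $ j * (if i = j then 1 else 0)) = X $ i $ i" for i
    by (simp add: if_distrib[of "\<lambda>t. _ * t"] sum.delta cong: if_cong)
  then show ?thesis by (simp add: trace_def inner_vec_def mat_def)
qed

lemma symmetric_mat_inner:
  "symmetric_mat X \<Longrightarrow> u \<bullet> (X *v v) = v \<bullet> (X *v u)"
  by (metis dot_lmul_matrix inner_commute symmetric_mat_def vector_transpose_matrix)

lemma subspace_symmetric_mat: "subspace {X :: real^'n^'n. symmetric_mat X}"
  unfolding subspace_def symmetric_mat_def transpose_def by (simp add: vec_eq_iff)

lemma orthogonal_matrix_row_inner:
  fixes W :: "real^'n^'n"
  assumes "orthogonal_matrix W"
  shows "W $ a \<bullet> W $ b = (if a = b then 1 else 0)"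
proof -
  have "(W ** transpose W) $ a $ b = (mat 1 :: real^'n^'n) $ a $ b"
    using assms by (simp add: orthogonal_matrix_def)
  then show ?thesis
    by (simp add: matrix_matrix_mult_def transpose_def mat_def inner_vec_def)
qed

lemma orthogonal_matrixI_rows:
  fixes W :: "real^'n^'n"
  assumes "\<And>a b. W $ a \<bullet> W $ b = (if a = b then 1 else 0)"
  shows "orthogonal_matrix W"
proof -
  have "W ** transpose W = mat 1"
    using assms by (simp add: matrix_matrix_mult_def transpose_def mat_def inner_vec_def vec_eq_iff)
  then show ?thesis using matrix_left_right_inverse orthogonal_matrix_def by blast
qed

text \<open>
  Orthonormal bases are encoded as orthogonal matrices throughout: the rows \<open>W $ a\<close> are the basis
  vectors. This makes the set of all bases a compact subset of a Euclidean space.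
\<close>

lemma row_basis_expand:
  fixes W :: "real^'n^'n"
  assumes "orthogonal_matrix W"
  shows "(\<Sum>a\<in>UNIV. (W $ a \<bullet> v) *\<^sub>R W $ a) = v"
proof -
  have "transpose W *v (W *v v) = v"
    using assms by (simp add: matrix_vector_mul_assoc orthogonal_matrix)
  then show ?thesis
    by (simp add: matrix_vector_mult_def transpose_def vec_eq_iff inner_vec_def mult.commute)
qed

lemma row_basis_parseval:
  fixes W :: "real^'n^'n"
  assumes "orthogonal_matrix W"
  shows "(\<Sum>a\<in>UNIV. (W $ a \<bullet> v)\<^sup>2) = v \<bullet> v"
proof -
  have "v \<bullet> v = v \<bullet> (\<Sum>a\<in>UNIV. (W $ a \<bullet> v) *\<^sub>R W $ a)"
    by (simp add: row_basis_expand[OF assms])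
  also have "\<dots> = (\<Sum>a\<in>UNIV. (W $ a \<bullet> v)\<^sup>2)"
    by (simp add: inner_sum_right inner_commute power2_eq_square)
  finally show ?thesis by simp
qed

lemma sum_outer_rows:
  fixes W :: "real^'n^'n"
  assumes "orthogonal_matrix W"
  shows "(\<Sum>a\<in>UNIV. outer (W $ a) (W $ a)) = mat 1"
proof -
  have "transpose W ** W = mat 1" using assms by (simp add: orthogonal_matrix)
  then show ?thesis
    by (simp add: outer_def matrix_matrix_mult_def transpose_def vec_eq_iff)
qed

lemma trace_row_basis:
  fixes W :: "real^'n^'n"
  assumes "orthogonal_matrix W"
  shows "(\<Sum>a\<in>UNIV. W $ a \<bullet> (X *v W $ a)) = trace X"
  unfolding trace_inner sum_outer_rows[OF assms, symmetric] inner_sum_right inner_outer ..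

section \<open>Matrices with a prescribed spectrum\<close>

text \<open>
  The matrix \<open>transpose W ** diag x ** W\<close>, which for orthogonal \<open>W\<close> has eigenvalue \<open>x $ a\<close> on the row
  \<open>W $ a\<close>.
\<close>

definition spectral_mat :: "real^'n^'n \<Rightarrow> real^'n \<Rightarrow> real^'n^'n" where
  "spectral_mat W x = (\<Sum>a\<in>UNIV. x $ a *\<^sub>R outer (W $ a) (W $ a))"

lemma sum_mult_vec:
  "(\<Sum>a\<in>I. B a) *v v = (\<Sum>a\<in>I. B a *v v)" for B :: "'a \<Rightarrow> real^'n^'n"
  by (induction I rule: infinite_finite_induct) (auto simp: matrix_vector_mult_add_rdistrib)

lemma spectral_mat_mult_vec: "spectral_mat W x *v v = (\<Sum>a\<in>UNIV. (x $ a * (W $ a \<bullet> v)) *\<^sub>R W $ a)"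
  by (simp add: spectral_mat_def sum_mult_vec scaleR_matrix_vector_assoc[symmetric]
      outer_mult_vec)

lemma spectral_mat_quadratic: "v \<bullet> (spectral_mat W x *v v) = (\<Sum>a\<in>UNIV. x $ a * (W $ a \<bullet> v)\<^sup>2)"
  by (simp add: spectral_mat_mult_vec inner_sum_right power2_eq_square inner_commute mult_ac)

lemma spectral_mat_row:
  assumes "orthogonal_matrix W"
  shows "spectral_mat W x *v W $ a = x $ a *\<^sub>R W $ a"
proof -
  have "(\<Sum>b\<in>UNIV. (x $ b * (W $ b \<bullet> W $ a)) *\<^sub>R W $ b)
      = (\<Sum>b\<in>UNIV. if b = a then x $ a *\<^sub>R W $ a else 0)"
    by (rule sum.cong) (auto simp: orthogonal_matrix_row_inner[OF assms])
  then show ?thesis by (simp add: spectral_mat_mult_vec)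
qed

lemma symmetric_spectral_mat: "symmetric_mat (spectral_mat W x)"
proof -
  have "transpose (\<Sum>a\<in>I. x $ a *\<^sub>R outer (W $ a) (W $ a)) = (\<Sum>a\<in>I. x $ a *\<^sub>R outer (W $ a) (W $ a))" for I
    by (induction I rule: infinite_finite_induct)
      (simp_all add: transpose_def outer_def vec_eq_iff mult_ac)
  then show ?thesis by (simp add: symmetric_mat_def spectral_mat_def)
qed

lemma trace_spectral_mat:
  assumes "orthogonal_matrix W"
  shows "trace (spectral_mat W x) = (\<Sum>a\<in>UNIV. x $ a)"
  unfolding trace_row_basis[OF assms, symmetric] spectral_mat_row[OF assms]
  by (simp add: orthogonal_matrix_row_inner[OF assms])

lemma eq_spectral_matI:
  fixes X :: "real^'n^'n"
  assumes W: "orthogonal_matrix W" and ev: "\<And>a. X *v W $ a = x $ a *\<^sub>R W $ a"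
  shows "X = spectral_mat W x"
proof -
  have "X *v v = spectral_mat W x *v v" for v
  proof -
    have "X *v v = X *v (\<Sum>a\<in>UNIV. (W $ a \<bullet> v) *\<^sub>R W $ a)" by (simp add: row_basis_expand[OF W])
    also have "\<dots> = (\<Sum>a\<in>UNIV. (W $ a \<bullet> v) *\<^sub>R (X *v W $ a))"
      by (simp add: linear_sum[OF matrix_vector_mul_linear] linear_scale[OF matrix_vector_mul_linear])
    also have "\<dots> = spectral_mat W x *v v" by (simp add: ev spectral_mat_mult_vec mult.commute)
    finally show ?thesis .
  qed
  then show ?thesis by (simp add: matrix_eq)
qed

lemma norm_spectral_mat_le:
  assumes W: "orthogonal_matrix W"
  shows "norm (spectral_mat W x) \<le> (\<Sum>a\<in>UNIV. \<bar>x $ a\<bar>)"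
proof -
  have "norm (outer (W $ a) (W $ a)) = 1" for a
    by (simp add: norm_eq_sqrt_inner inner_outer outer_mult_vec orthogonal_matrix_row_inner[OF W])
  then show ?thesis
    unfolding spectral_mat_def by (intro sum_norm_le) simp
qed

text \<open>
  The multiset of the \<open>l i\<close> is the multiset of roots of the product.
\<close>

lemma prod_linear_factors_permute:
  fixes l l' :: "'a::finite \<Rightarrow> real"
  assumes "\<And>t. (\<Prod>i\<in>UNIV. t - l i) = (\<Prod>i\<in>UNIV. t - l' i)"
  obtains p where "p permutes UNIV" "\<And>i. l i = l' (p i)"
proof -
  let ?P = "\<lambda>l::'a \<Rightarrow> real. \<Prod>i\<in>UNIV. [:- l i, 1:]"
  have "poly (?P l) t = poly (?P l') t" for t
    using assms[of t] by (simp add: poly_prod)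
  then have "?P l = ?P l'" by (simp add: poly_eq_poly_eq_iff[symmetric] fun_eq_iff)
  moreover have "proots (?P l) = image_mset l (mset_set UNIV)" for l :: "'a \<Rightarrow> real"
  proof -
    have "proots (?P l) = (\<Sum>i\<in>UNIV. proots [:- l i, 1:])" by (rule proots_prod) auto
    also have "\<dots> = image_mset l (mset_set UNIV)"
      by (simp add: sum_unfold_sum_mset image_mset.compositionality comp_def)
    finally show ?thesis .
  qed
  ultimately have "image_mset l (mset_set UNIV) = image_mset l' (mset_set UNIV)" by metis
  then show thesis using image_mset_eq_implies_permutes[of UNIV l l'] that by auto
qed

text \<open>
  In the basis of the rows of \<open>W\<close> the matrix \<open>mat t - spectral_mat W x\<close> is diagonal, and the change of
  basis does not affect the determinant.
\<close>

lemma eigenvalue_vector_spectral_mat: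
  fixes W :: "real^'n^'n"
  assumes W: "orthogonal_matrix W"
  shows "eigenvalue_vector (spectral_mat W x) x"
  unfolding eigenvalue_vector_def
proof
  fix t
  let ?Y = "mat t - spectral_mat W x"
  let ?D = "W ** ?Y ** transpose W"
  have Y: "?Y *v W $ b = (t - x $ b) *\<^sub>R W $ b" for b
  proof -
    have "mat t *v W $ b = t *\<^sub>R W $ b"
      by (simp add: vec_eq_iff matrix_vector_mult_def mat_def if_distrib[of "\<lambda>t. t * _"] cong: if_cong)
    then show ?thesis
      by (simp add: matrix_vector_mult_diff_rdistrib spectral_mat_row[OF W] algebra_simps)
  qed
  have D: "?D $ a $ b = (if a = b then t - x $ b else 0)" for a b
  proof -
    have "?D $ a $ b = W $ a \<bullet> (?Y *v W $ b)"
      by (simp add: matrix_mul_assoc[symmetric])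
         (simp add: matrix_matrix_mult_def transpose_def inner_vec_def matrix_vector_mult_def)
    then show ?thesis by (simp add: Y orthogonal_matrix_row_inner[OF W])
  qed
  have "det ?D = (\<Prod>i\<in>UNIV. t - x $ i)"
    by (subst det_diagonal) (simp_all add: D)
  moreover have "det ?D = det ?Y * (det W * det W)"
    by (simp add: det_mul det_transpose)
  moreover have "det W * det W = 1"
    by (metis W det_I det_mul det_transpose orthogonal_matrix)
  ultimately show "det ?Y = (\<Prod>i\<in>UNIV. t - x $ i)" by simp
qed

text \<open>
  The unspecified order of \<open>eigenvalues\<close> is harmless here: it differs from \<open>x\<close> by a permutation, which
  \<open>f\<close> does not see. From now on \<open>eigenvalues\<close> is only accessed through this lemma.
\<close>

lemma symmetric_fun_eigenvalues_spectral_mat: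
  assumes f: "symmetric_fun f" and W: "orthogonal_matrix W"
  shows "f (eigenvalues (spectral_mat W x)) = f x"
proof -
  let ?l = "eigenvalues (spectral_mat W x)"
  have "eigenvalue_vector (spectral_mat W x) ?l"
    unfolding eigenvalues_def by (rule someI, rule eigenvalue_vector_spectral_mat[OF W])
  then have "(\<Prod>i\<in>UNIV. t - ?l $ i) = (\<Prod>i\<in>UNIV. t - x $ i)" for t
    using eigenvalue_vector_spectral_mat[OF W, of x] by (simp add: eigenvalue_vector_def)
  then obtain p where "p permutes UNIV" "\<And>i. ?l $ i = x $ p i"
    using prod_linear_factors_permute[of "($) ?l" "($) x"] by blast
  moreover from this have "?l = (\<chi> i. x $ p i)" by (simp add: vec_eq_iff)
  ultimately show ?thesis using f by (simp add: symmetric_fun_def)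
qed

section \<open>Decreasing spectral decomposition\<close>

text \<open>
  Partial sums of sorted eigenvalues need an order on the index type. An arbitrary enumeration of it by
  \<open>0, \<dots>, n - 1\<close> provides one.
\<close>

definition coord :: "nat \<Rightarrow> 'n::finite" where
  "coord = (SOME e. bij_betw e {..<CARD('n)} UNIV)"

lemma bij_betw_coord: "bij_betw (coord :: nat \<Rightarrow> 'n::finite) {..<CARD('n)} UNIV"
proof -
  obtain e :: "nat \<Rightarrow> 'n" where "bij_betw e {..<CARD('n)} UNIV"
    using ex_bij_betw_nat_finite[of "UNIV :: 'n set"] by (auto simp: atLeast0LessThan)
  then show ?thesis unfolding coord_def by (rule someI[of "\<lambda>e. bij_betw e {..<CARD('n)} UNIV"])
qed

lemma coord_eq_iff:
  "i < CARD('n) \<Longrightarrow> j < CARD('n) \<Longrightarrow> (coord i :: 'n::finite) = coord j \<longleftrightarrow> i = j"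
  using bij_betw_coord[where 'n='n] by (auto simp: bij_betw_def inj_on_def)

lemma coord_cases:
  obtains i where "i < CARD('n)" "(a :: 'n::finite) = coord i"
  using bij_betw_coord[where 'n='n] unfolding bij_betw_def by (metis UNIV_I imageE lessThan_iff)

lemma sum_coord: "(\<Sum>i<CARD('n). g (coord i :: 'n::finite)) = (\<Sum>a\<in>UNIV. g a)"
  by (rule sum.reindex_bij_betw[OF bij_betw_coord])

definition leading_sum :: "real^'n \<Rightarrow> nat \<Rightarrow> real" where
  "leading_sum x j = (\<Sum>i<j. x $ coord i)"

definition decreasing :: "real^'n \<Rightarrow> bool" where
  "decreasing x \<longleftrightarrow> (\<forall>i j. i \<le> j \<longrightarrow> j < CARD('n) \<longrightarrow> x $ coord j \<le> x $ coord i)"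

lemma leading_sum_full: "leading_sum x CARD('n) = (\<Sum>a\<in>UNIV. x $ a)" for x :: "real^'n"
  unfolding leading_sum_def by (rule sum_coord)

text \<open>
  The first order condition at a maximum: a linear term in \<open>t\<close> cannot be dominated by a quadratic one
  near \<open>t = 0\<close>.
\<close>

lemma first_order_condition:
  fixes b K :: real
  assumes "\<And>t. 2 * t * b \<le> t\<^sup>2 * K"
  shows "b = 0"
proof (rule ccontr)
  assume b: "b \<noteq> 0"
  define k where "k = \<bar>K\<bar> + 1"
  have k: "k > 0" "K < k" by (auto simp: k_def)
  have "2 * (b / k) * b \<le> (b / k)\<^sup>2 * K" by (rule assms)
  then have "2 * b\<^sup>2 * k \<le> b\<^sup>2 * K"
    using k by (simp add: field_simps power2_eq_square)
  then have "2 * k \<le> K" using b by (simp add: mult.assoc mult.left_commute[of 2])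
  then show False using k by linarith
qed

text \<open>
  The eigenvectors are found one at a time, each as a maximizer of the quadratic form on the unit sphere
  of the orthogonal complement of the previous ones. Shrinking the complement can only lower the
  maximum, so the eigenvalues come out sorted; the last conjunct is the maximality that the induction
  needs for this.
\<close>

lemma leading_eigenvectors:
  fixes C :: "real^'n^'n"
  assumes sym: "symmetric_mat C" and "N \<le> CARD('n)"
  shows "\<exists>u c. (\<forall>i<N. \<forall>j<N. u i \<bullet> u j = (if i = j then 1 else 0))
      \<and> (\<forall>i<N. C *v u i = c i *\<^sub>R u i) \<and> (\<forall>i j. i \<le> j \<longrightarrow> j < N \<longrightarrow> c j \<le> c i)
      \<and> (\<forall>v. (\<forall>i<N. u i \<bullet> v = 0) \<longrightarrow> (\<forall>i<N. v \<bullet> (C *v v) \<le> c i * (v \<bullet> v)))"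
  using \<open>N \<le> CARD('n)\<close>
proof (induction N)
  case 0
  then show ?case by simp
next
  case (Suc N)
  then obtain u c where orth: "\<And>i j. i < N \<Longrightarrow> j < N \<Longrightarrow> u i \<bullet> u j = (if i = j then 1 else 0)"
    and ev: "\<And>i. i < N \<Longrightarrow> C *v u i = c i *\<^sub>R u i"
    and dec: "\<And>i j. i \<le> j \<Longrightarrow> j < N \<Longrightarrow> c j \<le> c i"
    and bnd: "\<And>v i. (\<forall>i<N. u i \<bullet> v = 0) \<Longrightarrow> i < N \<Longrightarrow> v \<bullet> (C *v v) \<le> c i * (v \<bullet> v)"
    by auto blast
  have "dim (u ` {..<N}) \<le> N"
    using dim_le_card'[of "u ` {..<N}"] card_image_le[of "{..<N}" u] by simp
  then have "dim (u ` {..<N}) < DIM(real^'n)" using Suc.prems by simp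
  then obtain x where x: "x \<noteq> 0" "\<And>y. y \<in> span (u ` {..<N}) \<Longrightarrow> orthogonal x y"
    by (rule orthogonal_to_subspace_exists) blast
  let ?T = "{v. norm v = 1} \<inter> (\<Inter>i<N. {v. u i \<bullet> v = 0})"
  have "compact ?T"
    by (intro compact_Int_closed closed_INT ballI closed_hyperplane)
      (use compact_sphere[of "0::real^'n" 1] in \<open>simp add: sphere_def\<close>)
  moreover have "x /\<^sub>R norm x \<in> ?T"
    using x by (auto simp: orthogonal_def span_base inner_commute[of "u _"])
  moreover have "continuous_on ?T (\<lambda>v. v \<bullet> (C *v v))"
    by (intro continuous_intros linear_continuous_on) (simp add: linear_linear)
  ultimately obtain w where w: "w \<in> ?T" and wmax: "\<And>v. v \<in> ?T \<Longrightarrow> v \<bullet> (C *v v) \<le> w \<bullet> (C *v w)"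
    using continuous_attains_sup[of ?T "\<lambda>v. v \<bullet> (C *v v)"] by blast
  define \<mu> where "\<mu> = w \<bullet> (C *v w)"
  have ww: "w \<bullet> w = 1" and wu: "\<And>i. i < N \<Longrightarrow> u i \<bullet> w = 0"
    using w by (auto simp: norm_eq_1)
  have \<mu>max: "v \<bullet> (C *v v) \<le> \<mu> * (v \<bullet> v)" if "\<forall>i<N. u i \<bullet> v = 0" for v
  proof (cases "v = 0")
    case False
    then have "v /\<^sub>R norm v \<in> ?T" using that by auto
    then have "(v /\<^sub>R norm v) \<bullet> (C *v (v /\<^sub>R norm v)) \<le> \<mu>" using wmax unfolding \<mu>_def by blast
    then have "(v \<bullet> (C *v v)) / (norm v)\<^sup>2 \<le> \<mu>"
      by (simp add: linear_scale[OF matrix_vector_mul_linear] power2_eq_square divide_inverse mult_ac)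
    then show ?thesis using False by (simp add: field_simps power2_norm_eq_inner)
  qed simp
  \<comment> \<open>The residual \<open>z\<close> is an admissible direction at the maximizer \<open>w\<close>, so it is orthogonal to
    \<open>C *v w\<close> and hence to itself.\<close>
  define z where "z = C *v w - \<mu> *\<^sub>R w"
  have zw: "z \<bullet> w = 0" by (simp add: z_def inner_diff_left \<mu>_def ww inner_commute[of "C *v w"])
  have zu: "u i \<bullet> z = 0" if "i < N" for i
    using that wu[OF that] symmetric_mat_inner[OF sym, of "u i" w]
    by (simp add: z_def inner_diff_right ev inner_commute[of w])
  have "z \<bullet> (C *v w) = 0"
  proof (rule first_order_condition)
    fix t
    have "(w + t *\<^sub>R z) \<bullet> (C *v (w + t *\<^sub>R z)) \<le> \<mu> * ((w + t *\<^sub>R z) \<bullet> (w + t *\<^sub>R z))"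
      by (rule \<mu>max) (auto simp: inner_add_right wu zu)
    then show "2 * t * (z \<bullet> (C *v w)) \<le> t\<^sup>2 * (\<mu> * (z \<bullet> z) - z \<bullet> (C *v z))"
      using symmetric_mat_inner[OF sym, of w z]
      by (simp add: linear_add[OF matrix_vector_mul_linear] linear_scale[OF matrix_vector_mul_linear]
          inner_add_left inner_add_right zw inner_commute[of w z] ww \<mu>_def[symmetric]
          power2_eq_square algebra_simps)
  qed
  then have "z \<bullet> z = 0"
    using zw by (simp add: z_def inner_diff_left inner_diff_right)
  then have evw: "C *v w = \<mu> *\<^sub>R w" by (simp add: z_def)
  let ?u = "u(N := w)" and ?c = "c(N := \<mu>)"
  have 1: "?u i \<bullet> ?u j = (if i = j then 1 else 0)" if "i < Suc N" "j < Suc N" for i j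
    using that orth ww wu by (auto simp: less_Suc_eq inner_commute)
  have 2: "C *v ?u i = ?c i *\<^sub>R ?u i" if "i < Suc N" for i
    using that ev evw by (auto simp: less_Suc_eq)
  have \<mu>c: "\<mu> \<le> c i" if "i < N" for i
    using bnd[of w i] wu that by (simp add: \<mu>_def ww)
  have 3: "?c j \<le> ?c i" if "i \<le> j" "j < Suc N" for i j
    using that dec \<mu>c by (auto simp: less_Suc_eq)
  have 4: "v \<bullet> (C *v v) \<le> ?c i * (v \<bullet> v)" if "\<forall>i<Suc N. ?u i \<bullet> v = 0" "i < Suc N" for v i
  proof -
    have "\<forall>i<N. u i \<bullet> v = 0" using that(1) by (metis fun_upd_other less_SucI less_irrefl)
    then show ?thesis using \<mu>max bnd that(2) by (auto simp: less_Suc_eq)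
  qed
  show ?case
    by (rule exI[of _ ?u], rule exI[of _ ?c]) (use 1 2 3 4 in blast)
qed

theorem spectral_decomposition:
  fixes C :: "real^'n^'n"
  assumes "symmetric_mat C"
  obtains W x where "orthogonal_matrix W" "decreasing x" "C = spectral_mat W x"
proof -
  obtain u c where u: "\<forall>i<CARD('n). \<forall>j<CARD('n). u i \<bullet> u j = (if i = j then 1 else 0)"
    and ev: "\<forall>i<CARD('n). C *v u i = c i *\<^sub>R u i"
    and dec: "\<forall>i j. i \<le> j \<longrightarrow> j < CARD('n) \<longrightarrow> c j \<le> c i"
    using leading_eigenvectors[OF assms order_refl] by blast
  let ?q = "the_inv_into {..<CARD('n)} (coord :: nat \<Rightarrow> 'n)"
  have q: "?q (coord i) = i" if "i < CARD('n)" for i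
    using bij_betw_coord[where 'n='n] that by (auto simp: bij_betw_def the_inv_into_f_f)
  define W :: "real^'n^'n" where "W = (\<chi> a. u (?q a))"
  define x :: "real^'n" where "x = (\<chi> a. c (?q a))"
  have W: "W $ coord i = u i" and x: "x $ coord i = c i" if "i < CARD('n)" for i
    using that q by (auto simp: W_def x_def)
  have orth: "orthogonal_matrix W"
  proof (rule orthogonal_matrixI_rows)
    fix a b :: 'n
    obtain i j where "i < CARD('n)" "a = coord i" "j < CARD('n)" "b = coord j"
      by (metis coord_cases)
    then show "W $ a \<bullet> W $ b = (if a = b then 1 else 0)"
      using u by (simp add: W coord_eq_iff)
  qed
  moreover have "decreasing x" using dec x by (simp add: decreasing_def)
  moreover have "C = spectral_mat W x"
  proof (rule eq_spectral_matI[OF orth])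
    fix a :: 'n
    obtain i where "i < CARD('n)" "a = coord i" by (rule coord_cases)
    then show "C *v W $ a = x $ a *\<^sub>R W $ a" using ev by (simp add: W x)
  qed
  ultimately show thesis by (rule that)
qed

section \<open>The Ky Fan inequality\<close>

text \<open>
  Weights in \<open>[0, 1]\<close> of total \<open>j\<close> do best on the \<open>j\<close> largest entries: after subtracting the \<open>j\<close>-th
  entry, those before it are nonnegative and gain from weight 1, those after it are nonpositive and gain
  from weight 0.
\<close>

lemma weighted_sum_le_leading_sum:
  fixes z t :: "nat \<Rightarrow> real"
  assumes dec: "\<And>i j. i \<le> j \<Longrightarrow> j < n \<Longrightarrow> z j \<le> z i"
    and t: "\<And>i. i < n \<Longrightarrow> 0 \<le> t i \<and> t i \<le> 1" "(\<Sum>i<n. t i) = real j" and "j \<le> n"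
  shows "(\<Sum>i<n. z i * t i) \<le> (\<Sum>i<j. z i)"
proof (cases j)
  case 0
  then have "\<forall>i<n. t i = 0" using t sum_nonneg_eq_0_iff[of "{..<n}" t] by auto
  then show ?thesis using 0 by simp
next
  case (Suc k)
  define c where "c = z k"
  have "(\<Sum>i<n. (z i - c) * t i) \<le> (\<Sum>i<n. if i < j then z i - c else 0)"
  proof (rule sum_mono)
    fix i assume i: "i \<in> {..<n}"
    show "(z i - c) * t i \<le> (if i < j then z i - c else 0)"
    proof (cases "i < j")
      case True
      then have "c \<le> z i" using dec[of i k] Suc \<open>j \<le> n\<close> by (simp add: c_def)
      then show ?thesis using t(1)[of i] i True by (simp add: mult_left_le)
    next
      case False
      then have "z i \<le> c" using dec[of k i] Suc i by (simp add: c_def)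
      then show ?thesis using t(1)[of i] i False by (simp add: mult_nonpos_nonneg)
    qed
  qed
  also have "\<dots> = (\<Sum>i<j. z i - c)"
  proof -
    have "{..<n} \<inter> {i. i < j} = {..<j}" using \<open>j \<le> n\<close> by auto
    then show ?thesis by (simp add: sum.If_cases)
  qed
  finally have "(\<Sum>i<n. (z i - c) * t i) \<le> (\<Sum>i<j. z i) - real j * c"
    by (simp add: sum_subtractf)
  moreover have "(\<Sum>i<n. (z i - c) * t i) = (\<Sum>i<n. z i * t i) - c * real j"
    by (simp add: left_diff_distrib sum_subtractf sum_distrib_left[symmetric] t(2))
  ultimately show ?thesis by simp
qed

definition diag_in :: "real^'n^'n \<Rightarrow> real^'n^'n \<Rightarrow> real^'n" where
  "diag_in W X = (\<chi> a. W $ a \<bullet> (X *v W $ a))"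

lemma leading_sum_diag_in_full:
  fixes W :: "real^'n^'n"
  shows "orthogonal_matrix W \<Longrightarrow> leading_sum (diag_in W X) CARD('n) = trace X"
  by (simp add: leading_sum_full diag_in_def trace_row_basis)

lemma diag_in_linear:
  "diag_in W (X + Y) = diag_in W X + diag_in W Y" "diag_in W (c *\<^sub>R X) = c *\<^sub>R diag_in W X"
  by (simp_all add: diag_in_def vec_eq_iff matrix_vector_mult_add_rdistrib inner_add_right
      scaleR_matrix_vector_assoc[symmetric])

lemma leading_sum_linear:
  "leading_sum (x + y) j = leading_sum x j + leading_sum y j"
  "leading_sum (c *\<^sub>R x) j = c * leading_sum x j"
  by (simp_all add: leading_sum_def sum.distrib sum_distrib_left)

lemma diag_in_spectral_mat: "orthogonal_matrix W \<Longrightarrow> diag_in W (spectral_mat W x) = x"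
  by (simp add: diag_in_def vec_eq_iff spectral_mat_row orthogonal_matrix_row_inner)

text \<open>
  The weights are the squared lengths of the projections of the eigenvectors \<open>U $ a\<close> onto the span of
  the first \<open>j\<close> rows of \<open>W\<close>.
\<close>

lemma ky_fan:
  fixes U W :: "real^'n^'n"
  assumes U: "orthogonal_matrix U" and W: "orthogonal_matrix W" and z: "decreasing z" and j: "j \<le> CARD('n)"
  shows "leading_sum (diag_in W (spectral_mat U z)) j \<le> leading_sum z j"
proof -
  define t where "t a = (\<Sum>i<j. (U $ a \<bullet> W $ coord i)\<^sup>2)" for a
  have "leading_sum (diag_in W (spectral_mat U z)) j = (\<Sum>a\<in>UNIV. z $ a * t a)"
    unfolding leading_sum_def diag_in_def t_def sum_distrib_left
    by (subst sum.swap) (simp add: spectral_mat_quadratic)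
  also have "\<dots> = (\<Sum>i<CARD('n). z $ coord i * t (coord i))" by (rule sum_coord[symmetric])
  also have "\<dots> \<le> (\<Sum>i<j. z $ coord i)"
  proof (rule weighted_sum_le_leading_sum)
    show "z $ coord i' \<le> z $ coord i" if "i \<le> i'" "i' < CARD('n)" for i i'
      using z that by (simp add: decreasing_def)
    show "0 \<le> t (coord i) \<and> t (coord i) \<le> 1" for i
    proof
      show "0 \<le> t (coord i)" by (simp add: t_def sum_nonneg)
      have "t (coord i) \<le> (\<Sum>k<CARD('n). (U $ coord i \<bullet> W $ coord k)\<^sup>2)"
        unfolding t_def using j by (intro sum_mono2) auto
      also have "\<dots> = (\<Sum>a\<in>UNIV. (U $ coord i \<bullet> W $ a)\<^sup>2)"
        by (rule sum_coord[where g = "\<lambda>a. (U $ coord i \<bullet> W $ a)\<^sup>2"])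
      also have "\<dots> = 1"
        using row_basis_parseval[OF W, of "U $ coord i"]
        by (simp add: inner_commute orthogonal_matrix_row_inner[OF U])
      finally show "t (coord i) \<le> 1" .
    qed
    have "(\<Sum>i<CARD('n). t (coord i)) = (\<Sum>a\<in>UNIV. t a)" by (rule sum_coord)
    also have "\<dots> = (\<Sum>i<j. \<Sum>a\<in>UNIV. (U $ a \<bullet> W $ coord i)\<^sup>2)"
      unfolding t_def by (rule sum.swap)
    also have "\<dots> = real j"
      by (simp add: row_basis_parseval[OF U] orthogonal_matrix_row_inner[OF W])
    finally show "(\<Sum>i<CARD('n). t (coord i)) = real j" .
  qed (rule j)
  finally show ?thesis by (simp add: leading_sum_def)
qed

text \<open>
  Summation by parts: the difference of the two sides is a combination of the partial sums of \<open>x - y\<close>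
  with the nonnegative weights \<open>c k - c (k + 1)\<close>.
\<close>

lemma abel_inequality:
  fixes c y x :: "nat \<Rightarrow> real"
  assumes dec: "\<And>i j. i \<le> j \<Longrightarrow> j < n \<Longrightarrow> c j \<le> c i"
    and le: "\<And>j. j \<le> n \<Longrightarrow> (\<Sum>i<j. y i) \<le> (\<Sum>i<j. x i)"
    and eq: "(\<Sum>i<n. y i) = (\<Sum>i<n. x i)"
  shows "(\<Sum>i<n. c i * y i) \<le> (\<Sum>i<n. c i * x i)"
proof -
  define d where "d j = (\<Sum>i<j. x i - y i)" for j
  have d: "d j \<ge> 0" if "j \<le> n" for j using le[OF that] by (simp add: d_def sum_subtractf)
  have "c k * d (Suc k) \<le> (\<Sum>i<Suc k. c i * (x i - y i))" if "k < n" for k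
    using that
  proof (induction k)
    case 0
    then show ?case by (simp add: d_def)
  next
    case (Suc k)
    have "c (Suc k) * d (Suc k) \<le> c k * d (Suc k)"
      using Suc.prems d[of "Suc k"] dec[of k "Suc k"] by (intro mult_right_mono) auto
    with Suc have "c (Suc k) * d (Suc k) \<le> (\<Sum>i<Suc k. c i * (x i - y i))" by linarith
    moreover have "d (Suc (Suc k)) = d (Suc k) + (x (Suc k) - y (Suc k))" by (simp add: d_def)
    ultimately show ?case by (simp add: distrib_left)
  qed
  moreover have "d n = 0" using eq by (simp add: d_def sum_subtractf)
  ultimately have "0 \<le> (\<Sum>i<n. c i * (x i - y i))"
    by (cases n) (force+)
  then show ?thesis by (simp add: right_diff_distrib sum_subtractf)
qed

section \<open>The convex hull as a majorization set\<close>

text \<open>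
  By \<open>ky_fan\<close> the largest value of \<open>leading_sum (diag_in W Y) j\<close> over all \<open>W\<close> is the sum of the \<open>j\<close>
  largest eigenvalues of a symmetric \<open>Y\<close>, so for decreasing \<open>x\<close> this says that \<open>x\<close> majorizes the
  spectrum of \<open>Y\<close>. In this form the condition is linear in \<open>(Y, x)\<close>.
\<close>

definition majorized_by :: "real^'n^'n \<Rightarrow> real^'n \<Rightarrow> bool" where
  "majorized_by Y x \<longleftrightarrow> trace Y = (\<Sum>a\<in>UNIV. x $ a) \<and>
     (\<forall>W j. orthogonal_matrix W \<longrightarrow> j \<le> CARD('n) \<longrightarrow> leading_sum (diag_in W Y) j \<le> leading_sum x j)"

definition bounding_vectors :: "(real^'n \<Rightarrow> real) \<Rightarrow> nat \<Rightarrow> (real^'n) set" where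
  "bounding_vectors f k = {x. decreasing x \<and> (\<forall>a. 0 \<le> x $ a) \<and>
     (\<forall>i. k \<le> i \<longrightarrow> i < CARD('n) \<longrightarrow> x $ coord i = 0) \<and> f x \<le> 0}"

definition majorized_set :: "(real^'n \<Rightarrow> real) \<Rightarrow> nat \<Rightarrow> (real^'n^'n) set" where
  "majorized_set f k = {Y. symmetric_mat Y \<and> (\<exists>x\<in>bounding_vectors f k. majorized_by Y x)}"

lemma symmetric_mat_combination:
  "symmetric_mat X \<Longrightarrow> symmetric_mat Y \<Longrightarrow> symmetric_mat (s *\<^sub>R X + t *\<^sub>R Y)"
  by (simp add: symmetric_mat_def transpose_def vec_eq_iff)

lemma convex_bounding_vectors:
  fixes f :: "real^'n \<Rightarrow> real"
  assumes "convex_on UNIV f"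
  shows "convex (bounding_vectors f k)"
proof (rule convexI)
  fix x y :: "real^'n" and s t :: real
  assume x: "x \<in> bounding_vectors f k" and y: "y \<in> bounding_vectors f k"
    and st: "0 \<le> s" "0 \<le> t" "s + t = 1"
  have "f (s *\<^sub>R x + t *\<^sub>R y) \<le> s * f x + t * f y"
    using assms st unfolding convex_on_def by auto
  also have "\<dots> \<le> 0"
    using x y st by (auto simp: bounding_vectors_def intro!: add_nonpos_nonpos mult_nonneg_nonpos)
  finally show "s *\<^sub>R x + t *\<^sub>R y \<in> bounding_vectors f k"
    using x y st by (auto simp: bounding_vectors_def decreasing_def intro!: add_mono mult_left_mono)
qed

lemma majorized_by_convex:
  assumes "majorized_by X x" "majorized_by Y y" "0 \<le> s" "0 \<le> t"
  shows "majorized_by (s *\<^sub>R X + t *\<^sub>R Y) (s *\<^sub>R x + t *\<^sub>R y)"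
  using assms unfolding majorized_by_def
  by (auto simp: trace_inner inner_add_left diag_in_linear leading_sum_linear sum.distrib sum_distrib_left
      intro!: add_mono mult_left_mono)

lemma convex_majorized_set:
  assumes "convex_on UNIV f"
  shows "convex (majorized_set f k)"
proof (rule convexI)
  fix X Y s t
  assume X: "X \<in> majorized_set f k" and Y: "Y \<in> majorized_set f k"
    and st: "0 \<le> s" "0 \<le> t" "s + t = (1::real)"
  obtain x y where x: "x \<in> bounding_vectors f k" "majorized_by X x"
    and y: "y \<in> bounding_vectors f k" "majorized_by Y y"
    using X Y by (auto simp: majorized_set_def)
  have "symmetric_mat (s *\<^sub>R X + t *\<^sub>R Y)"
    using X Y by (auto simp: majorized_set_def intro!: symmetric_mat_combination)
  then show "s *\<^sub>R X + t *\<^sub>R Y \<in> majorized_set f k"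
    using convexD[OF convex_bounding_vectors[OF assms] x(1) y(1) st]
      majorized_by_convex[OF x(2) y(2) st(1,2)]
    by (auto simp: majorized_set_def)
qed

lemma psd_spectral_mat:
  assumes "\<And>a. 0 \<le> x $ a"
  shows "spectral_mat W x \<in> psd"
  by (simp add: psd_def symmetric_spectral_mat spectral_mat_quadratic sum_nonneg assms)

lemma psd_spectral_mat_nonneg:
  assumes "spectral_mat W x \<in> psd" "orthogonal_matrix W"
  shows "0 \<le> x $ a"
proof -
  have "0 \<le> W $ a \<bullet> (spectral_mat W x *v W $ a)" using assms(1) by (simp add: psd_def)
  then show ?thesis by (simp add: spectral_mat_row[OF assms(2)] orthogonal_matrix_row_inner[OF assms(2)])
qed

lemma rank_spectral_mat:
  fixes W :: "real^'n^'n"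
  assumes W: "orthogonal_matrix W"
  shows "rank (spectral_mat W x) = card {a. x $ a \<noteq> 0}"
proof -
  let ?I = "{a. x $ a \<noteq> 0}"
  let ?B = "(\<lambda>a. W $ a) ` ?I"
  have "range (\<lambda>v. spectral_mat W x *v v) \<subseteq> span ?B"
  proof clarify
    fix v
    show "spectral_mat W x *v v \<in> span ?B"
      unfolding spectral_mat_mult_vec
      by (intro span_sum) (metis (mono_tags, lifting) image_eqI mem_Collect_eq mult_zero_left
          scaleR_zero_left span_base span_scale span_zero)
  qed
  moreover have "?B \<subseteq> range (\<lambda>v. spectral_mat W x *v v)"
  proof clarify
    fix a assume "x $ a \<noteq> 0"
    then have "W $ a = spectral_mat W x *v ((1 / x $ a) *\<^sub>R W $ a)"
      by (simp add: linear_scale[OF matrix_vector_mul_linear] spectral_mat_row[OF W])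
    then show "W $ a \<in> range (\<lambda>v. spectral_mat W x *v v)" by (rule range_eqI)
  qed
  ultimately have "dim (range (\<lambda>v. spectral_mat W x *v v)) = dim ?B"
    by (metis dim_mono dim_span dim_subset order_antisym)
  moreover have ind: "independent ?B"
  proof (rule pairwise_orthogonal_independent)
    show "pairwise orthogonal ?B"
      unfolding pairwise_def orthogonal_def by (auto simp: orthogonal_matrix_row_inner[OF W])
    show "0 \<notin> ?B"
    proof
      assume "0 \<in> ?B"
      then obtain a where "W $ a = 0" by force
      then show False using orthogonal_matrix_row_inner[OF W, of a a] by simp
    qed
  qed
  moreover have "inj_on (\<lambda>a. W $ a) ?I"
    by (rule inj_onI) (metis W orthogonal_matrix_row_inner zero_neq_one)
  ultimately show ?thesis
    by (simp add: rank_dim_range dim_eq_card_independent card_image)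
qed

lemma rank_spectral_mat_le_iff:
  fixes x :: "real^'n"
  assumes W: "orthogonal_matrix W" and dec: "decreasing x" and nn: "\<And>a. 0 \<le> x $ a"
  shows "rank (spectral_mat W x) \<le> k \<longleftrightarrow> (\<forall>i. k \<le> i \<longrightarrow> i < CARD('n) \<longrightarrow> x $ coord i = 0)"
proof -
  let ?J = "{i. i < CARD('n) \<and> x $ coord i \<noteq> 0}"
  have "bij_betw (coord :: nat \<Rightarrow> 'n) ?J {a. x $ a \<noteq> 0}"
    using bij_betw_coord[where 'n='n] unfolding bij_betw_def inj_on_def
    by auto
  then have r: "rank (spectral_mat W x) = card ?J"
    by (simp add: rank_spectral_mat[OF W] bij_betw_same_card)
  show ?thesis
  proof
    assume le: "rank (spectral_mat W x) \<le> k"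
    show "\<forall>i. k \<le> i \<longrightarrow> i < CARD('n) \<longrightarrow> x $ coord i = 0"
    proof (intro allI impI, rule ccontr)
      fix i assume i: "k \<le> i" "i < CARD('n)" "x $ coord i \<noteq> 0"
      have "{..i} \<subseteq> ?J"
      proof clarsimp
        fix l assume "l \<le> i"
        then have "x $ coord i \<le> x $ coord l" using dec i by (simp add: decreasing_def)
        then show "l < CARD('n) \<and> x $ coord l \<noteq> 0"
          using i nn[of "coord i"] \<open>l \<le> i\<close> by auto
      qed
      then have "card {..i} \<le> card ?J" by (intro card_mono) auto
      then show False using r le i by simp
    qed
  next
    assume zero: "\<forall>i. k \<le> i \<longrightarrow> i < CARD('n) \<longrightarrow> x $ coord i = 0"
    have "i < k" if "i \<in> ?J" for i
    proof (rule ccontr)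
      assume "\<not> i < k"
      then have "k \<le> i" by simp
      then show False using zero[rule_format, of i] that by blast
    qed
    then have "?J \<subseteq> {..<k}" by blast
    then have "card ?J \<le> card {..<k}" by (rule card_mono[OF finite_lessThan])
    then show "rank (spectral_mat W x) \<le> k" unfolding r by simp
  qed
qed

lemma domain_set_subset_majorized_set:
  assumes f: "symmetric_fun f"
  shows "domain_set f k \<subseteq> majorized_set f k"
proof
  fix X assume X: "X \<in> domain_set f k"
  then obtain W x where W: "orthogonal_matrix W" and x: "decreasing x" and Xeq: "X = spectral_mat W x"
    using spectral_decomposition[of X] by (auto simp: domain_set_def psd_def)
  have nn: "0 \<le> x $ a" for a
    using X W psd_spectral_mat_nonneg by (auto simp: domain_set_def Xeq)
  have "x \<in> bounding_vectors f k"
    using X rank_spectral_mat_le_iff[OF W x nn] symmetric_fun_eigenvalues_spectral_mat[OF f W] nn x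
    by (simp add: domain_set_def Xeq bounding_vectors_def)
  moreover have "majorized_by X x"
    unfolding majorized_by_def Xeq using ky_fan[OF W _ x] trace_spectral_mat[OF W] by blast
  ultimately show "X \<in> majorized_set f k"
    by (auto simp: majorized_set_def Xeq symmetric_spectral_mat)
qed

lemma spectral_mat_in_domain_set:
  assumes f: "symmetric_fun f" and W: "orthogonal_matrix W" and x: "x \<in> bounding_vectors f k"
  shows "spectral_mat W x \<in> domain_set f k"
proof -
  have dec: "decreasing x" and nn: "0 \<le> x $ a" for a
    using x by (simp_all add: bounding_vectors_def)
  have "rank (spectral_mat W x) \<le> k"
    using x rank_spectral_mat_le_iff[OF W dec nn] by (simp add: bounding_vectors_def)
  then show ?thesis
    using x psd_spectral_mat[OF nn] symmetric_fun_eigenvalues_spectral_mat[OF f W]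
    by (simp add: domain_set_def bounding_vectors_def)
qed

lemma compact_orthogonal_matrices: "compact {W :: real^'n^'n. orthogonal_matrix W}"
proof (rule compact_eq_bounded_closed[THEN iffD2], rule conjI)
  have "norm W \<le> real CARD('n)" if "orthogonal_matrix W" for W :: "real^'n^'n"
  proof -
    have "norm W \<le> (\<Sum>a\<in>UNIV. norm (W $ a))"
      unfolding norm_vec_def by (rule L2_set_le_sum) simp
    also have "\<dots> = real CARD('n)"
      using orthogonal_matrix_row_inner[OF that] by (simp add: norm_eq_sqrt_inner)
    finally show ?thesis .
  qed
  then show "bounded {W :: real^'n^'n. orthogonal_matrix W}"
    by (auto intro: boundedI)
  have "{W :: real^'n^'n. orthogonal_matrix W} = (\<Inter>a. \<Inter>b. {W. W $ a \<bullet> W $ b = (if a = b then 1 else 0)})"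
    by (auto simp: orthogonal_matrix_row_inner intro!: orthogonal_matrixI_rows)
  also have "closed \<dots>"
    by (intro closed_INT ballI closed_Collect_eq continuous_intros)
  finally show "closed {W :: real^'n^'n. orthogonal_matrix W}" .
qed

lemma continuous_on_spectral_mat: "continuous_on S (\<lambda>W. spectral_mat W x)"
  unfolding spectral_mat_def outer_def by (intro continuous_intros)

text \<open>
  The matrix form of Rado's theorem. A separating functional may be taken to be symmetric. In its
  eigenbasis \<open>V\<close> it only sees the diagonal of \<open>Y\<close>, and by \<open>abel_inequality\<close> the orbit point
  \<open>spectral_mat V x\<close> has a value at least as large as \<open>Y\<close>.
\<close>

lemma majorized_in_orbit_hull:
  fixes Y :: "real^'n^'n"
  assumes sym: "symmetric_mat Y" and maj: "majorized_by Y x"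
  shows "Y \<in> convex hull ((\<lambda>W. spectral_mat W x) ` {W. orthogonal_matrix W})" (is "Y \<in> ?K")
proof (rule ccontr)
  assume Y: "Y \<notin> ?K"
  have "closed ?K"
    by (intro compact_imp_closed compact_convex_hull compact_continuous_image
        continuous_on_spectral_mat compact_orthogonal_matrices)
  then obtain a b where ab: "a \<bullet> Y < b" "\<And>Z. Z \<in> ?K \<Longrightarrow> b < a \<bullet> Z"
    using separating_hyperplane_closed_point[OF convex_convex_hull _ Y] by blast
  \<comment> \<open>On symmetric matrices \<open>C\<close> acts as \<open>- 2 * a\<close>; the sign turns the strict lower bound on the
    hull into an upper bound.\<close>
  define C where "C = - (a + transpose a)"
  have "symmetric_mat C"
    by (simp add: C_def symmetric_mat_def transpose_def vec_eq_iff)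
  then obtain V c where V: "orthogonal_matrix V" and c: "decreasing c" and C: "C = spectral_mat V c"
    by (rule spectral_decomposition)
  have inner_C: "C \<bullet> Z = - 2 * (a \<bullet> Z)" if "symmetric_mat Z" for Z
  proof -
    have "transpose a \<bullet> Z = a \<bullet> transpose Z"
      unfolding inner_vec_def transpose_def by simp (rule sum.swap)
    then show ?thesis using that by (simp add: C_def inner_diff_left symmetric_mat_def)
  qed
  have C_inner: "spectral_mat V c \<bullet> Z = (\<Sum>i<CARD('n). c $ coord i * diag_in V Z $ coord i)" for Z
    unfolding sum_coord[where g="\<lambda>a. c $ a * diag_in V Z $ a"]
    by (simp add: spectral_mat_def inner_sum_left inner_commute[of "outer _ _"] inner_outer diag_in_def)
  have "(\<Sum>i<CARD('n). c $ coord i * diag_in V Y $ coord i) \<le> (\<Sum>i<CARD('n). c $ coord i * x $ coord i)"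
  proof (rule abel_inequality)
    show "c $ coord j \<le> c $ coord i" if "i \<le> j" "j < CARD('n)" for i j
      using c that by (simp add: decreasing_def)
    show "(\<Sum>i<j. diag_in V Y $ coord i) \<le> (\<Sum>i<j. x $ coord i)" if "j \<le> CARD('n)" for j
      using maj V that unfolding majorized_by_def leading_sum_def by blast
    show "(\<Sum>i<CARD('n). diag_in V Y $ coord i) = (\<Sum>i<CARD('n). x $ coord i)"
      using leading_sum_diag_in_full[OF V, of Y] leading_sum_full[of x] maj
      by (simp add: leading_sum_def majorized_by_def)
  qed
  then have "C \<bullet> Y \<le> C \<bullet> spectral_mat V x"
    unfolding C C_inner diag_in_spectral_mat[OF V] .
  moreover have "spectral_mat V x \<in> ?K" using V by (intro hull_inc) auto
  ultimately show False
    using ab inner_C[OF sym] inner_C[OF symmetric_spectral_mat[of V x]] by force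
qed

text \<open>
  The whole orbit of a bounding vector lies in the domain set, so the hull of the orbit lies in the hull
  of the domain set.
\<close>

theorem convex_hull_domain_set:
  assumes f: "symmetric_fun f" "convex_on UNIV f"
  shows "convex hull (domain_set f k) = majorized_set f k"
proof
  show "convex hull (domain_set f k) \<subseteq> majorized_set f k"
    by (rule hull_minimal[of _ _ convex, OF domain_set_subset_majorized_set[OF f(1)]])
      (rule convex_majorized_set[OF f(2)])
  show "majorized_set f k \<subseteq> convex hull (domain_set f k)"
  proof
    fix Y assume "Y \<in> majorized_set f k"
    then obtain x where x: "x \<in> bounding_vectors f k" and "symmetric_mat Y" "majorized_by Y x"
      by (auto simp: majorized_set_def)
    then have "Y \<in> convex hull ((\<lambda>W. spectral_mat W x) ` {W. orthogonal_matrix W})"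
      by (intro majorized_in_orbit_hull)
    also have "\<dots> \<subseteq> convex hull (domain_set f k)"
      using spectral_mat_in_domain_set[OF f(1) _ x] by (intro hull_mono) auto
    finally show "Y \<in> convex hull (domain_set f k)" .
  qed
qed

lemma leading_sum_diag_in_le_trace:
  fixes Y :: "real^'n^'n"
  assumes Y: "Y \<in> psd" and W: "orthogonal_matrix W" and j: "j \<le> CARD('n)"
  shows "leading_sum (diag_in W Y) j \<le> trace Y"
proof -
  have "leading_sum (diag_in W Y) j \<le> leading_sum (diag_in W Y) CARD('n)"
    unfolding leading_sum_def using j Y by (intro sum_mono2) (auto simp: diag_in_def psd_def)
  then show ?thesis by (simp add: leading_sum_diag_in_full[OF W])
qed

lemma majorized_set_subset_psd:
  fixes f :: "real^'n \<Rightarrow> real"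
  assumes f: "symmetric_fun f" "convex_on UNIV f"
  shows "majorized_set f k \<subseteq> psd"
proof -
  have "convex (psd :: (real^'n^'n) set)"
  proof (rule convexI)
    fix X Y :: "real^'n^'n" and s t :: real
    assume *: "X \<in> psd" "Y \<in> psd" "0 \<le> s" "0 \<le> t" "s + t = 1"
    then have "symmetric_mat (s *\<^sub>R X + t *\<^sub>R Y)"
      by (auto simp: psd_def intro!: symmetric_mat_combination)
    with * show "s *\<^sub>R X + t *\<^sub>R Y \<in> psd"
      by (simp add: psd_def matrix_vector_mult_add_rdistrib inner_add_right
          scaleR_matrix_vector_assoc[symmetric])
  qed
  then have "convex hull (domain_set f k) \<subseteq> psd"
    by (intro hull_minimal) (auto simp: domain_set_def)
  then show ?thesis by (simp add: convex_hull_domain_set[OF f])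
qed

text \<open>
  The set is the projection of a closed set of pairs \<open>(X, x)\<close>. The trace bounds both components, because
  the spectrum of \<open>X\<close> and the vector \<open>x\<close> are nonnegative with sum \<open>\<tau>\<close>.
\<close>

lemma compact_majorized_set_trace:
  fixes f :: "real^'n \<Rightarrow> real"
  assumes f: "symmetric_fun f" "convex_on UNIV f" "continuous_on UNIV f"
  shows "compact {X \<in> majorized_set f k. trace X = \<tau>}"
proof -
  let ?P = "{(X, x). symmetric_mat X \<and> x \<in> bounding_vectors f k \<and> majorized_by X x \<and> trace X = \<tau>}
    :: ((real^'n^'n) \<times> (real^'n)) set"
  have "bounded ?P"
  proof (rule boundedI)
    fix p assume "p \<in> ?P"
    then obtain X x where p: "p = (X, x)" and X: "symmetric_mat X" "majorized_by X x" "trace X = \<tau>"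
      and x: "x \<in> bounding_vectors f k" by blast
    have "X \<in> psd" using majorized_set_subset_psd[OF f(1,2)] X x by (auto simp: majorized_set_def)
    obtain W l where W: "orthogonal_matrix W" and Xl: "X = spectral_mat W l"
      using spectral_decomposition[OF X(1)] by blast
    have "norm X \<le> \<tau>"
      using norm_spectral_mat_le[OF W, of l] psd_spectral_mat_nonneg[OF _ W, of l]
        \<open>X \<in> psd\<close> X(3) trace_spectral_mat[OF W]
      by (simp add: Xl)
    moreover have "norm x \<le> \<tau>"
      using norm_le_l1_cart[of x] x X(2,3) by (auto simp: majorized_by_def bounding_vectors_def)
    ultimately show "norm p \<le> \<tau> + \<tau>"
      using norm_Pair_le[of X x] p by simp
  qed
  moreover have "closed ?P"
  proof -
    have "?P = {p. transpose (fst p) = fst p}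
       \<inter> (\<Inter>i. \<Inter>j\<in>{j. i \<le> j \<and> j < CARD('n)}. {p. snd p $ coord j \<le> snd p $ coord i})
       \<inter> (\<Inter>a. {p. 0 \<le> snd p $ a})
       \<inter> (\<Inter>i\<in>{i. k \<le> i \<and> i < CARD('n)}. {p. snd p $ coord i = 0})
       \<inter> {p. f (snd p) \<le> 0}
       \<inter> {p. trace (fst p) = (\<Sum>a\<in>UNIV. snd p $ a)}
       \<inter> (\<Inter>W\<in>{W. orthogonal_matrix W}. \<Inter>j\<in>{..CARD('n)}. {p. leading_sum (diag_in W (fst p)) j \<le> leading_sum (snd p) j})
       \<inter> {p. trace (fst p) = \<tau>}"
      by (auto simp: symmetric_mat_def bounding_vectors_def decreasing_def majorized_by_def)
    also have "closed \<dots>"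
      unfolding trace_inner leading_sum_def diag_in_def transpose_def matrix_vector_mult_def
      by (intro closed_Int closed_INT ballI closed_Collect_eq closed_Collect_le continuous_intros
          continuous_on_compose2[OF f(3)]) simp_all
    finally show ?thesis .
  qed
  ultimately have "compact (fst ` ?P)"
    by (intro compact_continuous_image continuous_intros) (simp add: compact_eq_bounded_closed)
  moreover have "fst ` ?P = {X \<in> majorized_set f k. trace X = \<tau>}"
    by (force simp: majorized_set_def)
  ultimately show ?thesis by simp
qed

section \<open>Symmetric matrices supported on a block of eigenvectors\<close>

text \<open>
  For orthogonal \<open>U\<close>, a symmetric \<open>\<Delta>\<close> has this property exactly if it is a combination of the
  outer products of the vectors \<open>U $ coord i\<close> with \<open>i \<in> B\<close>. The estimate is the form in which the
  support is used: a small multiple of \<open>\<Delta>\<close> is absorbed by any positive amount of the projection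
  onto the block.
\<close>

definition block_bounded :: "real^'n^'n \<Rightarrow> nat set \<Rightarrow> real^'n^'n \<Rightarrow> bool" where
  "block_bounded U B \<Delta> \<longleftrightarrow>
     (\<exists>c\<ge>0. \<forall>v. \<bar>v \<bullet> (\<Delta> *v v)\<bar> \<le> c * (\<Sum>i\<in>B. (U $ coord i \<bullet> v)\<^sup>2))"

lemma subspace_block_bounded: "subspace {\<Delta>. block_bounded U B \<Delta>}"
proof (rule subspaceI; (rule CollectI | drule CollectD)+)
  show "block_bounded U B 0" unfolding block_bounded_def by (intro exI[of _ 0]) simp
next
  fix X Y assume "block_bounded U B X" "block_bounded U B Y"
  then obtain c d where cd: "0 \<le> c" "0 \<le> d"
    and X: "\<And>v. \<bar>v \<bullet> (X *v v)\<bar> \<le> c * (\<Sum>i\<in>B. (U $ coord i \<bullet> v)\<^sup>2)"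
    and Y: "\<And>v. \<bar>v \<bullet> (Y *v v)\<bar> \<le> d * (\<Sum>i\<in>B. (U $ coord i \<bullet> v)\<^sup>2)"
    unfolding block_bounded_def by blast
  have "\<bar>v \<bullet> ((X + Y) *v v)\<bar> \<le> (c + d) * (\<Sum>i\<in>B. (U $ coord i \<bullet> v)\<^sup>2)" for v
    using X[of v] Y[of v]
    by (simp add: matrix_vector_mult_add_rdistrib inner_add_right distrib_right)
  then show "block_bounded U B (X + Y)"
    unfolding block_bounded_def using cd by (intro exI[of _ "c + d"]) simp
next
  fix a X assume "block_bounded U B X"
  then obtain c where c: "0 \<le> c"
    and X: "\<And>v. \<bar>v \<bullet> (X *v v)\<bar> \<le> c * (\<Sum>i\<in>B. (U $ coord i \<bullet> v)\<^sup>2)"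
    unfolding block_bounded_def by blast
  have "\<bar>v \<bullet> ((a *\<^sub>R X) *v v)\<bar> \<le> (\<bar>a\<bar> * c) * (\<Sum>i\<in>B. (U $ coord i \<bullet> v)\<^sup>2)" for v
    using mult_left_mono[OF X[of v], of "\<bar>a\<bar>"]
    by (simp add: scaleR_matrix_vector_assoc[symmetric] abs_mult mult.assoc)
  then show "block_bounded U B (a *\<^sub>R X)"
    unfolding block_bounded_def using c by (intro exI[of _ "\<bar>a\<bar> * c"]) simp
qed

definition sym_outer :: "real^'n^'n \<Rightarrow> nat \<Rightarrow> nat \<Rightarrow> real^'n^'n" where
  "sym_outer U i j = outer (U $ coord i) (U $ coord j) + outer (U $ coord j) (U $ coord i)"

lemma symmetric_sym_outer: "symmetric_mat (sym_outer U i j)"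
  by (simp add: sym_outer_def symmetric_mat_def transpose_def outer_def vec_eq_iff)

lemma block_bounded_sym_outer:
  assumes "finite B" "i \<in> B" "j \<in> B"
  shows "block_bounded U B (sym_outer U i j)"
  unfolding block_bounded_def
proof (intro exI[of _ 2] conjI allI)
  fix v
  let ?x = "U $ coord i \<bullet> v" and ?y = "U $ coord j \<bullet> v" and ?S = "\<Sum>i\<in>B. (U $ coord i \<bullet> v)\<^sup>2"
  have "?x\<^sup>2 \<le> ?S" "?y\<^sup>2 \<le> ?S"
    using assms by (auto intro!: member_le_sum[of _ B "\<lambda>i. (U $ coord i \<bullet> v)\<^sup>2"])
  moreover have "v \<bullet> (sym_outer U i j *v v) = 2 * (?x * ?y)"
    by (simp add: sym_outer_def matrix_vector_mult_add_rdistrib outer_mult_vec inner_add_right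
        inner_commute)
  moreover have "\<bar>2 * (?x * ?y)\<bar> \<le> ?x\<^sup>2 + ?y\<^sup>2"
    using sum_squares_bound[of "\<bar>?x\<bar>" "\<bar>?y\<bar>"] by (simp add: abs_mult)
  ultimately show "\<bar>v \<bullet> (sym_outer U i j *v v)\<bar> \<le> 2 * ?S" by linarith
qed simp

text \<open>
  The products with \<open>i \<le> j\<close> are pairwise orthogonal and nonzero, so the dimension is the number of
  such pairs.
\<close>

lemma dim_sym_outer_span:
  fixes U :: "real^'n^'n"
  assumes U: "orthogonal_matrix U" and r: "s \<le> r" "r \<le> CARD('n)"
  shows "2 * dim (span ((\<lambda>(j, i). sym_outer U i j) ` (SIGMA j:{s..<r}. {s..j}))) = (r - s) * (r - s + 1)"
proof -
  let ?I = "SIGMA j:{s..<r}. {s..j}"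
  let ?g = "\<lambda>(j, i). sym_outer U i j"
  define \<delta> where "\<delta> i j = U $ coord i \<bullet> U $ coord j" for i j
  have \<delta>: "\<delta> i j = (if i = j then 1 else 0)" if "i < CARD('n)" "j < CARD('n)" for i j
    using that by (simp add: \<delta>_def orthogonal_matrix_row_inner[OF U] coord_eq_iff)
  have inner: "sym_outer U i j \<bullet> sym_outer U k l = 2 * (\<delta> i k * \<delta> j l) + 2 * (\<delta> i l * \<delta> j k)" for i j k l
    by (simp add: sym_outer_def inner_outer_outer inner_add_left inner_add_right \<delta>_def)
  have ne: "?g p \<bullet> ?g q = 0" if "p \<in> ?I" "q \<in> ?I" "p \<noteq> q" for p q
  proof -
    obtain i j k l where "p = (j, i)" "q = (l, k)" by (metis surj_pair)
    then show ?thesis using that r by (auto simp: inner \<delta>)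
  qed
  have self: "?g p \<bullet> ?g p \<noteq> 0" if "p \<in> ?I" for p
  proof -
    obtain i j where p: "p = (j, i)" by (metis surj_pair)
    then have "i < CARD('n)" "j < CARD('n)" using that r by auto
    then have "?g p \<bullet> ?g p = 2 + 2 * (\<delta> i j * \<delta> i j)"
      using \<delta>[of i i] \<delta>[of j j] by (simp add: p inner) (simp add: \<delta>_def inner_commute)
    also have "\<dots> > 0" using zero_le_square[of "\<delta> i j"] by linarith
    finally show ?thesis by simp
  qed
  have "inj_on ?g ?I" by (rule inj_onI) (metis ne self)
  moreover have "independent (?g ` ?I)"
  proof (rule pairwise_orthogonal_independent)
    show "pairwise orthogonal (?g ` ?I)"
      unfolding pairwise_def orthogonal_def
    proof (intro ballI impI)
      fix x y assume "x \<in> ?g ` ?I" "y \<in> ?g ` ?I" "x \<noteq> y"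
      then obtain p q where "p \<in> ?I" "q \<in> ?I" and xy: "x = ?g p" "y = ?g q" by (elim imageE)
      then show "x \<bullet> y = 0" using ne[of p q] \<open>x \<noteq> y\<close> by metis
    qed
    show "0 \<notin> ?g ` ?I"
    proof
      assume "0 \<in> ?g ` ?I"
      then obtain p where "p \<in> ?I" "0 = ?g p" by (elim imageE)
      then show False using self[of p] by (metis inner_zero_left)
    qed
  qed
  ultimately have "dim (span (?g ` ?I)) = card ?I"
    by (simp add: dim_eq_card_independent card_image)
  also have "\<dots> = (\<Sum>j\<in>{s..<r}. Suc j - s)" by simp
  finally have d: "dim (span (?g ` ?I)) = (\<Sum>j\<in>{s..<r}. Suc j - s)" .
  have "2 * (\<Sum>j\<in>{s..<r}. Suc j - s) = (r - s) * (r - s + 1)"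
    using r(1)
  proof (induction r rule: dec_induct)
    case (step m)
    then show ?case by (simp add: Suc_diff_le algebra_simps)
  qed simp
  then show ?thesis unfolding d .
qed

lemma exists_orthogonal_in_larger_span:
  fixes E G :: "'a::euclidean_space set"
  assumes "dim (span G) < dim (span E)"
  obtains x where "x \<in> span E" "x \<noteq> 0" "\<And>g. g \<in> G \<Longrightarrow> g \<bullet> x = 0"
proof -
  let ?O = "{y \<in> UNIV. \<forall>x\<in>span G. orthogonal x y}"
  have sub: "subspace ?O" by (auto simp: subspace_def orthogonal_def inner_add_right)
  have "dim ?O + dim (span G) = DIM('a)"
    using dim_subspace_orthogonal_to_vectors[of "span G" UNIV] by simp
  moreover have "dim {x + y |x y. x \<in> span E \<and> y \<in> ?O} + dim (span E \<inter> ?O) = dim (span E) + dim ?O"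
    by (rule dim_sums_Int) (use sub in auto)
  moreover have "dim {x + y |x y. x \<in> span E \<and> y \<in> ?O} \<le> DIM('a)" by (rule dim_subset_UNIV)
  ultimately have "dim (span E \<inter> ?O) \<noteq> 0" using assms by linarith
  then have "\<not> span E \<inter> ?O \<subseteq> {0}" unfolding dim_eq_0 .
  then obtain x where x: "x \<in> span E" "x \<in> ?O" "x \<noteq> 0" by blast
  moreover have "g \<bullet> x = 0" if "g \<in> G" for g
    using x(2) span_base[OF that] by (simp add: orthogonal_def)
  ultimately show thesis using that by blast
qed

section \<open>Perturbations inside the majorization set\<close>

lemma eventually_small_multiple:
  fixes c d :: real
  assumes "0 < d"
  shows "\<forall>\<^sub>F \<epsilon> in at_right 0. 0 < \<epsilon> \<and> \<epsilon> * c \<le> d"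
proof -
  have "((\<lambda>\<epsilon>. \<epsilon> * c) \<longlongrightarrow> 0 * c) (at_right 0)" by (intro tendsto_intros)
  then have "\<forall>\<^sub>F \<epsilon> in at_right 0. \<epsilon> * c < d" using assms by (intro order_tendstoD) auto
  then show ?thesis
    using eventually_at_right_less[of "0::real"] by eventually_elim auto
qed

text \<open>
  If \<open>l\<close> were constant between the indices \<open>j - 1\<close> and \<open>k - 1\<close>, the concave partial sums of \<open>x\<close>, which
  touch the partial sums of \<open>l\<close> from above at \<open>j\<close>, would stay at or below them up to \<open>k\<close>.
\<close>

lemma tight_partial_sum_gap:
  fixes x l :: "real^'n"
  assumes dec: "decreasing x" "decreasing l"
    and maj: "\<And>i. i \<le> CARD('n) \<Longrightarrow> leading_sum l i \<le> leading_sum x i"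
    and k: "k \<le> CARD('n)" "leading_sum l k < leading_sum x k"
    and j: "0 < j" "j < k" "leading_sum l j = leading_sum x j"
  shows "l $ coord (k - 1) < l $ coord (j - 1)"
proof (rule ccontr)
  assume "\<not> ?thesis"
  then have flat: "l $ coord (j - 1) \<le> l $ coord (k - 1)" by simp
  have "leading_sum x j = leading_sum x (j - 1) + x $ coord (j - 1)"
    "leading_sum l j = leading_sum l (j - 1) + l $ coord (j - 1)"
    using j(1) by (cases j; simp add: leading_sum_def)+
  then have xl: "x $ coord (j - 1) \<le> l $ coord (j - 1)"
    using maj[of "j - 1"] j(2,3) k(1) by linarith
  have split: "leading_sum y k = leading_sum y j + (\<Sum>i=j..<k. y $ coord i)" for y :: "real^'n"
    unfolding leading_sum_def using j(2) by (simp add: lessThan_atLeast0 sum.atLeastLessThan_concat)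
  have "(\<Sum>i=j..<k. x $ coord i) \<le> (\<Sum>i=j..<k. l $ coord i)"
  proof (rule sum_mono)
    fix i assume i: "i \<in> {j..<k}"
    have "x $ coord i \<le> x $ coord (j - 1)" "l $ coord (k - 1) \<le> l $ coord i"
      using dec i k j by (auto simp: decreasing_def)
    then show "x $ coord i \<le> l $ coord i" using xl flat by linarith
  qed
  then show False using split[of x] split[of l] j(3) k(2) by simp
qed

text \<open>
  The same vector \<open>x\<close> majorizes the perturbed matrix. There are finitely many indices \<open>j\<close>, and each of
  them only asks \<open>\<epsilon>\<close> to be small. The block starts at \<open>k - 1\<close> and not at \<open>k\<close>: the inequality of
  index \<open>k\<close> is already strict, so mass may be exchanged between the eigenvectors \<open>k - 1\<close> and \<open>k\<close>.
\<close>

lemma eventually_perturbed_in_majorized_set: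
  fixes f :: "real^'n \<Rightarrow> real"
  assumes f: "symmetric_fun f" "convex_on UNIV f"
    and X: "spectral_mat U l \<in> majorized_set f k" and U: "orthogonal_matrix U" and l: "decreasing l"
    and k: "1 \<le> k" "k < r" "r \<le> CARD('n)" and pos_l: "0 < l $ coord (r - 1)"
    and \<Delta>: "symmetric_mat \<Delta>" "trace \<Delta> = 0" "block_bounded U {k - 1..<r} \<Delta>"
  shows "\<forall>\<^sub>F \<epsilon> in at_right 0. spectral_mat U l + \<epsilon> *\<^sub>R \<Delta> \<in> majorized_set f k"
proof -
  let ?B = "{k - 1..<r}"
  define q where "q v = (\<Sum>i\<in>?B. (U $ coord i \<bullet> v)\<^sup>2)" for v
  have q0: "0 \<le> q v" for v by (simp add: q_def sum_nonneg)
  obtain c where c: "0 \<le> c" and cb: "\<And>v. \<bar>v \<bullet> (\<Delta> *v v)\<bar> \<le> c * q v"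
    using \<Delta>(3) unfolding block_bounded_def q_def by blast
  obtain x where x: "x \<in> bounding_vectors f k" and maj: "majorized_by (spectral_mat U l) x"
    using X by (auto simp: majorized_set_def)
  have l0: "0 \<le> l $ a" for a
    using X majorized_set_subset_psd[OF f] psd_spectral_mat_nonneg[OF _ U] by blast
  have lx: "leading_sum l j \<le> leading_sum x j" if "j \<le> CARD('n)" for j
    using maj U that diag_in_spectral_mat[OF U] unfolding majorized_by_def by metis
  have tr: "trace (spectral_mat U l) = leading_sum x CARD('n)" "leading_sum l CARD('n) = leading_sum x CARD('n)"
    using maj trace_spectral_mat[OF U] by (simp_all add: majorized_by_def leading_sum_full)
  have x_full: "leading_sum x j = leading_sum x CARD('n)" if "k \<le> j" "j \<le> CARD('n)" for j
    unfolding leading_sum_def using that x by (intro sum.mono_neutral_left) (auto simp: bounding_vectors_def)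
  have "leading_sum l k < leading_sum l CARD('n)"
    unfolding leading_sum_def by (rule sum_strict_mono2[of _ _ "r - 1"]) (use k pos_l l0 in auto)
  then have lxk: "leading_sum l k < leading_sum x k" using tr x_full[of k] k by simp
  have block_le: "(\<Sum>i\<in>?B. w (coord i) * (U $ coord i \<bullet> v)\<^sup>2) \<le> (\<Sum>a\<in>UNIV. w a * (U $ a \<bullet> v)\<^sup>2)"
    if "\<And>a. 0 \<le> w a" for w v
  proof -
    have "(\<Sum>i\<in>?B. w (coord i) * (U $ coord i \<bullet> v)\<^sup>2) \<le> (\<Sum>i<CARD('n). w (coord i) * (U $ coord i \<bullet> v)\<^sup>2)"
      using k that by (intro sum_mono2) auto
    also have "\<dots> = (\<Sum>a\<in>UNIV. w a * (U $ a \<bullet> v)\<^sup>2)"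
      by (rule sum_coord[where g = "\<lambda>a. w a * (U $ a \<bullet> v)\<^sup>2"])
    finally show ?thesis .
  qed
  have block_gain: "d * q v \<le> (\<Sum>a\<in>UNIV. w a * (U $ a \<bullet> v)\<^sup>2)"
    if "\<And>a. 0 \<le> w a" "\<And>i. i \<in> ?B \<Longrightarrow> d \<le> w (coord i)" for w d v
    using block_le[of w v] that sum_mono[of ?B "\<lambda>i. d * (U $ coord i \<bullet> v)\<^sup>2" "\<lambda>i. w (coord i) * (U $ coord i \<bullet> v)\<^sup>2"]
    by (simp add: q_def sum_distrib_left mult_right_mono)
  have quad: "v \<bullet> ((spectral_mat U l + \<epsilon> *\<^sub>R \<Delta>) *v v) = v \<bullet> (spectral_mat U l *v v) + \<epsilon> * (v \<bullet> (\<Delta> *v v))" for v \<epsilon>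
    by (simp add: matrix_vector_mult_add_rdistrib inner_add_right scaleR_matrix_vector_assoc[symmetric])
  have small: "\<bar>\<epsilon> * (v \<bullet> (\<Delta> *v v))\<bar> \<le> d * q v" if "0 < \<epsilon>" "\<epsilon> * c \<le> d" for \<epsilon> d v
  proof -
    have "\<bar>\<epsilon> * (v \<bullet> (\<Delta> *v v))\<bar> \<le> \<epsilon> * (c * q v)"
      using cb[of v] that by (simp add: abs_mult)
    also have "\<dots> \<le> d * q v" using mult_right_mono[OF that(2) q0[of v]] by (simp add: mult.assoc)
    finally show ?thesis .
  qed
  have sym: "symmetric_mat (spectral_mat U l + \<epsilon> *\<^sub>R \<Delta>)" for \<epsilon>
    using subspace_symmetric_mat \<Delta>(1) symmetric_spectral_mat unfolding subspace_def by blast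
  have trY: "trace (spectral_mat U l + \<epsilon> *\<^sub>R \<Delta>) = leading_sum x CARD('n)" for \<epsilon>
    using tr \<Delta>(2) by (simp add: trace_inner inner_add_left)
  have "\<forall>\<^sub>F \<epsilon> in at_right 0. \<forall>W. orthogonal_matrix W \<longrightarrow>
      leading_sum (diag_in W (spectral_mat U l + \<epsilon> *\<^sub>R \<Delta>)) j \<le> leading_sum x j" if j: "j \<le> CARD('n)" for j
  proof -
    consider "leading_sum l j < leading_sum x j" | "leading_sum l j = leading_sum x j" "k \<le> j"
      | "j = 0" | "leading_sum l j = leading_sum x j" "0 < j" "j < k"
      using lx[OF j] by linarith
    then show ?thesis
    proof cases
      \<comment> \<open>There is slack, and the diagonal entries of \<open>\<Delta>\<close> are bounded.\<close>
      case 1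
      have qle: "q v \<le> v \<bullet> v" for v
        using block_gain[of "\<lambda>_. 1" 1 v] row_basis_parseval[OF U, of v] by simp
      have "\<forall>\<^sub>F \<epsilon> in at_right 0. 0 < \<epsilon> \<and> \<epsilon> * (c * j) \<le> leading_sum x j - leading_sum l j"
        using 1 by (intro eventually_small_multiple) simp
      then show ?thesis
      proof eventually_elim
        case (elim \<epsilon>)
        show ?case
        proof (intro allI impI)
          fix W :: "real^'n^'n" assume W: "orthogonal_matrix W"
          have "diag_in W \<Delta> $ a \<le> c" for a
            using cb[of "W $ a"] mult_left_mono[OF qle[of "W $ a"] c]
            by (simp add: diag_in_def orthogonal_matrix_row_inner[OF W])
          then have "leading_sum (diag_in W \<Delta>) j \<le> c * j"
            unfolding leading_sum_def using sum_bounded_above[of "{..<j}" "\<lambda>i. diag_in W \<Delta> $ coord i" c]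
            by (simp add: mult.commute)
          then have "\<epsilon> * leading_sum (diag_in W \<Delta>) j \<le> \<epsilon> * (c * j)" using elim by simp
          then show "leading_sum (diag_in W (spectral_mat U l + \<epsilon> *\<^sub>R \<Delta>)) j \<le> leading_sum x j"
            using ky_fan[OF U W l j] conjunct2[OF elim] unfolding diag_in_linear leading_sum_linear
            by linarith
        qed
      qed
    next
      \<comment> \<open>The right-hand side is the whole trace, so positive semidefiniteness of the perturbed
        matrix suffices.\<close>
      case 2
      have "\<forall>\<^sub>F \<epsilon> in at_right 0. 0 < \<epsilon> \<and> \<epsilon> * c \<le> l $ coord (r - 1)"
        by (rule eventually_small_multiple[OF pos_l])
      then show ?thesis
      proof eventually_elim
        case (elim \<epsilon>)
        have "0 \<le> v \<bullet> ((spectral_mat U l + \<epsilon> *\<^sub>R \<Delta>) *v v)" for v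
        proof -
          have "l $ coord (r - 1) * q v \<le> v \<bullet> (spectral_mat U l *v v)"
            unfolding spectral_mat_quadratic using l k
            by (intro block_gain l0) (auto simp: decreasing_def)
          then show ?thesis using small[of \<epsilon> _ v] elim by (force simp: quad)
        qed
        then have "spectral_mat U l + \<epsilon> *\<^sub>R \<Delta> \<in> psd" using sym by (simp add: psd_def)
        then show ?case
          using leading_sum_diag_in_le_trace[OF _ _ j] x_full[OF 2(2) j] by (metis trY)
      qed
    next
      case 3
      then show ?thesis by (simp add: leading_sum_def)
    next
      \<comment> \<open>The perturbed matrix stays below \<open>spectral_mat U z\<close>, where \<open>z\<close> lifts the eigenvalues
        after the first \<open>j\<close> to the \<open>j\<close>-th one; this does not change the sum of the \<open>j\<close> largest.\<close>
      case 4
      define h where "h = l $ coord (j - 1)"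
      define z where "z = (\<chi> a. max (l $ a) h)"
      have z_dec: "decreasing z"
        using l unfolding decreasing_def z_def by (auto intro: max.mono simp: max.coboundedI1)
      have "z $ coord i = l $ coord i" if "i < j" for i
      proof -
        have "i \<le> j - 1" "j - 1 < CARD('n)" using that j by auto
        then have "h \<le> l $ coord i" using l unfolding h_def decreasing_def by blast
        then show ?thesis by (simp add: z_def)
      qed
      then have zj: "leading_sum z j = leading_sum x j" using 4 by (simp add: leading_sum_def)
      have "l $ coord (k - 1) < h"
        unfolding h_def using x l lx lxk 4 k
        by (intro tight_partial_sum_gap[of x]) (auto simp: bounding_vectors_def)
      then have "\<forall>\<^sub>F \<epsilon> in at_right 0. 0 < \<epsilon> \<and> \<epsilon> * c \<le> h - l $ coord (k - 1)"
        by (intro eventually_small_multiple) simp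
      then show ?thesis
      proof eventually_elim
        case (elim \<epsilon>)
        have dom: "v \<bullet> ((spectral_mat U l + \<epsilon> *\<^sub>R \<Delta>) *v v) \<le> v \<bullet> (spectral_mat U z *v v)" for v
        proof -
          have "(h - l $ coord (k - 1)) * q v \<le> (\<Sum>a\<in>UNIV. (z $ a - l $ a) * (U $ a \<bullet> v)\<^sup>2)"
          proof (rule block_gain)
            show "0 \<le> z $ a - l $ a" for a by (simp add: z_def)
            show "h - l $ coord (k - 1) \<le> z $ coord i - l $ coord i" if "i \<in> ?B" for i
            proof -
              have "l $ coord i \<le> l $ coord (k - 1)" using l that k by (auto simp: decreasing_def)
              then show ?thesis by (simp add: z_def)
            qed
          qed
          also have "\<dots> = v \<bullet> (spectral_mat U z *v v) - v \<bullet> (spectral_mat U l *v v)"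
            by (simp add: spectral_mat_quadratic left_diff_distrib sum_subtractf)
          finally show ?thesis using small[of \<epsilon> _ v] elim by (force simp: quad)
        qed
        show ?case
        proof (intro allI impI)
          fix W :: "real^'n^'n" assume W: "orthogonal_matrix W"
          have "leading_sum (diag_in W (spectral_mat U l + \<epsilon> *\<^sub>R \<Delta>)) j \<le> leading_sum (diag_in W (spectral_mat U z)) j"
            unfolding leading_sum_def by (rule sum_mono) (simp add: diag_in_def dom)
          also have "\<dots> \<le> leading_sum x j" using ky_fan[OF U W z_dec j] zj by simp
          finally show "leading_sum (diag_in W (spectral_mat U l + \<epsilon> *\<^sub>R \<Delta>)) j \<le> leading_sum x j" .
        qed
      qed
    qed
  qed
  then have "\<forall>\<^sub>F \<epsilon> in at_right 0. \<forall>j\<in>{..CARD('n)}. \<forall>W. orthogonal_matrix W \<longrightarrow>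
      leading_sum (diag_in W (spectral_mat U l + \<epsilon> *\<^sub>R \<Delta>)) j \<le> leading_sum x j"
    by (intro eventually_ball_finite) auto
  then show ?thesis
  proof eventually_elim
    case (elim \<epsilon>)
    then have "majorized_by (spectral_mat U l + \<epsilon> *\<^sub>R \<Delta>) x"
      using trY by (simp add: majorized_by_def leading_sum_full)
    then show ?case using x sym by (auto simp: majorized_set_def)
  qed
qed

text \<open>
  The space of admissible symmetric \<open>\<Delta>\<close> has dimension \<open>(q + 1) (q + 2) / 2\<close> with
  \<open>q = rank X - k\<close>. The summand 1 next to \<open>dim (span G)\<close> pays for the trace condition, which is
  orthogonality to \<open>mat 1\<close>.
\<close>

lemma two_sided_perturbation:
  fixes f :: "real^'n \<Rightarrow> real" and G :: "(real^'n^'n) set"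
  assumes f: "symmetric_fun f" "convex_on UNIV f"
    and X: "X \<in> majorized_set f k" and k: "1 \<le> k" "k < rank X"
    and G: "2 * (dim (span G) + 1) < (rank X - k + 1) * (rank X - k + 2)"
  obtains \<Delta> where "\<Delta> \<noteq> 0" "trace \<Delta> = 0" "\<And>g. g \<in> G \<Longrightarrow> g \<bullet> \<Delta> = 0"
    "X + \<Delta> \<in> majorized_set f k" "X - \<Delta> \<in> majorized_set f k"
proof -
  let ?r = "rank X"
  have sym: "symmetric_mat X" using X by (simp add: majorized_set_def)
  obtain U l where U: "orthogonal_matrix U" and l: "decreasing l" and Xl: "X = spectral_mat U l"
    using spectral_decomposition[OF sym] .
  have r: "?r \<le> CARD('n)" using rank_bound[of X] by simp
  have l0: "0 \<le> l $ a" for a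
    using X majorized_set_subset_psd[OF f] psd_spectral_mat_nonneg[OF _ U] Xl by blast
  have "\<not> rank (spectral_mat U l) \<le> ?r - 1" using k by (simp add: Xl)
  then obtain i where i: "?r - 1 \<le> i" "i < CARD('n)" "l $ coord i \<noteq> 0"
    using rank_spectral_mat_le_iff[OF U l l0] by blast
  then have "l $ coord i \<le> l $ coord (?r - 1)" using l by (simp add: decreasing_def)
  then have pos_l: "0 < l $ coord (?r - 1)" using l0[of "coord i"] i by simp
  define E where "E = (\<lambda>(j, i). sym_outer U i j) ` (SIGMA j:{k - 1..<?r}. {k - 1..j})"
  have "?r - (k - 1) = ?r - k + 1" "?r - (k - 1) + 1 = ?r - k + 2" using k by auto
  then have dim_E: "2 * dim (span E) = (?r - k + 1) * (?r - k + 2)"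
    unfolding E_def using dim_sym_outer_span[OF U _ r, of "k - 1"] k by (simp only:)
  have "dim (span (insert (mat 1) G)) \<le> dim (span G) + 1"
    by (simp add: dim_insert)
  moreover have "dim (span G) + 1 < dim (span E)" using G unfolding dim_E[symmetric] by simp
  ultimately have "dim (span (insert (mat 1) G)) < dim (span E)" by linarith
  then obtain \<Delta> where \<Delta>: "\<Delta> \<in> span E" "\<Delta> \<noteq> 0" "\<And>g. g \<in> insert (mat 1) G \<Longrightarrow> g \<bullet> \<Delta> = 0"
    using exists_orthogonal_in_larger_span by blast
  have E: "E \<subseteq> {\<Delta>. symmetric_mat \<Delta>} \<inter> {\<Delta>. block_bounded U {k - 1..<?r} \<Delta>}"
    by (auto simp: E_def intro: symmetric_sym_outer block_bounded_sym_outer)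
  have "span E \<subseteq> {\<Delta>. symmetric_mat \<Delta>} \<inter> {\<Delta>. block_bounded U {k - 1..<?r} \<Delta>}"
    by (rule span_minimal[OF E]) (intro subspace_inter subspace_symmetric_mat subspace_block_bounded)
  then have D: "symmetric_mat D" "block_bounded U {k - 1..<?r} D" if "D \<in> span E" for D
    using that by blast+
  have tr: "trace \<Delta> = 0" using \<Delta>(3)[of "mat 1"] by (simp add: trace_inner inner_commute)
  then have tr': "trace (- \<Delta>) = 0" by (simp add: trace_inner)
  have XU: "spectral_mat U l \<in> majorized_set f k" using X unfolding Xl .
  note perturb = eventually_perturbed_in_majorized_set[OF f XU U l k r pos_l]
  from perturb[OF D(1)[OF \<Delta>(1)] tr D(2)[OF \<Delta>(1)]]
    perturb[OF D(1)[OF span_neg[OF \<Delta>(1)]] tr' D(2)[OF span_neg[OF \<Delta>(1)]]]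
  have "\<forall>\<^sub>F \<epsilon> in at_right 0. 0 < \<epsilon> \<and> X + \<epsilon> *\<^sub>R \<Delta> \<in> majorized_set f k \<and> X - \<epsilon> *\<^sub>R \<Delta> \<in> majorized_set f k"
    using eventually_at_right_less[of "0::real"] unfolding Xl[symmetric]
    by eventually_elim simp
  then obtain \<epsilon> where "0 < \<epsilon>" "X + \<epsilon> *\<^sub>R \<Delta> \<in> majorized_set f k" "X - \<epsilon> *\<^sub>R \<Delta> \<in> majorized_set f k"
    using eventually_happens trivial_limit_at_right_real by blast
  then show thesis
    using \<Delta> tr by (intro that[of "\<epsilon> *\<^sub>R \<Delta>"]) (auto simp: trace_inner)
qed

lemma not_extreme_point_if_two_sided:
  fixes X :: "'a::real_vector"
  assumes "\<Delta> \<noteq> 0" "X + \<Delta> \<in> S" "X - \<Delta> \<in> S"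
  shows "\<not> X extreme_point_of S"
proof
  assume "X extreme_point_of S"
  moreover have "X \<in> open_segment (X - \<Delta>) (X + \<Delta>)"
  proof -
    have "X = (1 - 1/2) *\<^sub>R (X - \<Delta>) + (1/2) *\<^sub>R (X + \<Delta>)"
      by (simp add: algebra_simps scaleR_add_left[symmetric])
    moreover have "X - \<Delta> \<noteq> X + \<Delta>"
    proof
      assume "X - \<Delta> = X + \<Delta>"
      then have "2 *\<^sub>R \<Delta> = 0" by (simp add: scaleR_2 algebra_simps)
      then show False using assms(1) by simp
    qed
    ultimately show ?thesis
      unfolding in_segment by (intro conjI exI[of _ "1/2"]) auto
  qed
  ultimately show False using assms by (auto simp: extreme_point_of_def)
qed

text \<open>
  Squaring \<open>sqrt (2 m + 9/4) < q + 3/2\<close> gives \<open>2 m < q\<^sup>2 + 3 q\<close>.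
\<close>

lemma rank_excess_imp_dimension_count:
  fixes q m :: nat
  assumes "\<lfloor>sqrt (2 * real m + 9 / 4) - 3 / 2\<rfloor> < int q"
  shows "2 * (m + 1) < (q + 1) * (q + 2)"
proof -
  have "sqrt (2 * real m + 9 / 4) - 3 / 2 < real q"
    using assms by (simp add: floor_less_iff)
  then have "sqrt (2 * real m + 9 / 4) < real q + 3 / 2" by simp
  then have "2 * real m + 9 / 4 < (real q + 3 / 2)\<^sup>2"
    by (meson not_le real_le_rsqrt)
  then have "real (2 * (m + 1)) < real ((q + 1) * (q + 2))"
    by (simp add: power2_eq_square algebra_simps)
  then show ?thesis by (simp only: of_nat_less_iff)
qed

lemma strengthened_rank_properties:
  assumes "1 \<le> k"
  shows "1 \<le> strengthened_rank f k"
    "convex hull (domain_set f k) = convex hull (domain_set f (strengthened_rank f k))"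
proof -
  have "1 \<le> strengthened_rank f k \<and> strengthened_rank f k \<le> k \<and>
      convex hull (domain_set f k) = convex hull (domain_set f (strengthened_rank f k))"
    unfolding strengthened_rank_def by (rule LeastI[of _ k]) (use assms in simp)
  then show "1 \<le> strengthened_rank f k"
    "convex hull (domain_set f k) = convex hull (domain_set f (strengthened_rank f k))" by auto
qed

section \<open>Rank bounds for the relaxation\<close>

theorem theorem2:
  fixes f :: "real^'n \<Rightarrow> real"
    and k m :: nat
    and A :: "nat \<Rightarrow> real^'n^'n"
    and bl bu :: "nat \<Rightarrow> ereal"
  defines "kt \<equiv> strengthened_rank f k"
    and "mt \<equiv> dim (span (A ` {1..m}))"
    and "S \<equiv> lsop_r_feasible f k m A bl bu"
  assumes "1 \<le> k" and "k \<le> CARD('n)"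
    and "continuous_on UNIV f" and "convex_on UNIV f" and "symmetric_fun f"
    and "\<And>i. i \<le> m \<Longrightarrow> symmetric_mat (A i)"
    and "\<And>i. i \<in> {1..m} \<Longrightarrow> bl i \<le> bu i"
  shows "(\<forall>X. X extreme_point_of S \<longrightarrow>
            int (rank X) \<le> int kt + \<lfloor>sqrt (2 * real mt + 9 / 4) - 3 / 2\<rfloor>) \<and>
         (\<forall>V_rel. is_min_value (\<lambda>X. A 0 \<bullet> X) S V_rel \<and> -\<infinity> < V_rel \<and> V_rel < \<infinity> \<longrightarrow>
            (\<exists>X. optimal_solution (\<lambda>X. A 0 \<bullet> X) S X \<and>
               int (rank X) \<le> int kt + \<lfloor>sqrt (2 * real mt + 9 / 4) - 3 / 2\<rfloor>))"
proof -
  let ?bound = "int kt + \<lfloor>sqrt (2 * real mt + 9 / 4) - 3 / 2\<rfloor>"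
  note cont = \<open>continuous_on UNIV f\<close> and f = \<open>symmetric_fun f\<close> \<open>convex_on UNIV f\<close>
  let ?M = "majorized_set f kt"
  have kt: "1 \<le> kt" unfolding kt_def by (rule strengthened_rank_properties[OF \<open>1 \<le> k\<close>])
  have "convex hull (domain_set f k) = ?M"
    unfolding kt_def convex_hull_domain_set[OF f, symmetric]
    by (rule strengthened_rank_properties[OF \<open>1 \<le> k\<close>])
  then have S: "S = {X \<in> ?M. \<forall>i\<in>{1..m}. bl i \<le> ereal (A i \<bullet> X) \<and> ereal (A i \<bullet> X) \<le> bu i}"
    by (simp add: S_def lsop_r_feasible_def)
  have direction: "\<exists>\<Delta>. \<Delta> \<noteq> 0 \<and> trace \<Delta> = 0 \<and> X + \<Delta> \<in> S \<and> X - \<Delta> \<in> S"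
    if X: "X \<in> S" and rank: "?bound < int (rank X)" for X
  proof -
    have "0 \<le> \<lfloor>sqrt (2 * real mt + 9 / 4) - 3 / 2\<rfloor>"
    proof -
      have "3 / 2 \<le> sqrt (2 * real mt + 9 / 4)" by (rule real_le_rsqrt) (simp add: power2_eq_square)
      then show ?thesis by simp
    qed
    then have kr: "kt < rank X" using rank by linarith
    then have "\<lfloor>sqrt (2 * real mt + 9 / 4) - 3 / 2\<rfloor> < int (rank X - kt)" using rank by linarith
    then have "2 * (mt + 1) < (rank X - kt + 1) * (rank X - kt + 2)"
      by (rule rank_excess_imp_dimension_count)
    then obtain \<Delta> where \<Delta>: "\<Delta> \<noteq> 0" "trace \<Delta> = 0" "\<And>g. g \<in> A ` {1..m} \<Longrightarrow> g \<bullet> \<Delta> = 0"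
      "X + \<Delta> \<in> ?M" "X - \<Delta> \<in> ?M"
      using two_sided_perturbation[OF f _ kt kr, of "A ` {1..m}"] X unfolding S mt_def by blast
    moreover have "A i \<bullet> (X + \<Delta>) = A i \<bullet> X" "A i \<bullet> (X - \<Delta>) = A i \<bullet> X" if "i \<in> {1..m}" for i
      using \<Delta>(3) that by (simp_all add: inner_add_right inner_diff_right)
    ultimately have "X + \<Delta> \<in> S" "X - \<Delta> \<in> S" using X by (simp_all add: S)
    with \<Delta> show ?thesis by blast
  qed
  show ?thesis
  proof (intro conjI allI impI)
    fix X assume ext: "X extreme_point_of S"
    then have "X \<in> S" by (simp add: extreme_point_of_def)
    with ext direction show "int (rank X) \<le> ?bound"
      by (meson not_extreme_point_if_two_sided not_le)
  next
    fix V assume "is_min_value (\<lambda>X. A 0 \<bullet> X) S V \<and> -\<infinity> < V \<and> V < \<infinity>"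
    then have V: "V = (INF X\<in>S. ereal (A 0 \<bullet> X))" and "\<exists>X\<in>S. ereal (A 0 \<bullet> X) = V"
      by (auto simp: is_min_value_def)
    then obtain X0 where X0: "X0 \<in> S" "ereal (A 0 \<bullet> X0) = V" by blast
    have lower: "A 0 \<bullet> X0 \<le> A 0 \<bullet> X" if "X \<in> S" for X
    proof -
      have "V \<le> ereal (A 0 \<bullet> X)" unfolding V by (rule INF_lower[OF that])
      then show ?thesis by (simp add: X0(2)[symmetric])
    qed
    \<comment> \<open>Without the trace condition the optimal set may be unbounded; the directions of
      \<open>direction\<close> preserve the trace.\<close>
    define T where "T = {X \<in> S. trace X = trace X0 \<and> A 0 \<bullet> X = A 0 \<bullet> X0}"
    have "T = {X \<in> ?M. trace X = trace X0} \<inter> {X. A 0 \<bullet> X = A 0 \<bullet> X0}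
        \<inter> (\<Inter>i\<in>{1..m}. {X. bl i \<le> ereal (A i \<bullet> X)} \<inter> {X. ereal (A i \<bullet> X) \<le> bu i})"
      by (auto simp: T_def S)
    also have "compact \<dots>"
      by (intro compact_Int_closed compact_majorized_set_trace[OF f cont] closed_INT ballI
          closed_Int closed_hyperplane closed_Collect_le continuous_intros)
    finally have "compact T" .
    moreover have "convex T"
    proof -
      have "convex {X. trace X = trace X0}" for X0 :: "real^'n^'n"
        unfolding trace_inner inner_commute[of _ "mat 1"] by (rule convex_hyperplane)
      moreover have "convex {X. bl i \<le> ereal (A i \<bullet> X)}" for i
      proof (cases "bl i")
        case (real b)
        then show ?thesis using convex_halfspace_ge[of b "A i"] by simp
      qed auto
      moreover have "convex {X. ereal (A i \<bullet> X) \<le> bu i}" for i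
      proof (cases "bu i")
        case (real b)
        then show ?thesis using convex_halfspace_le[of "A i" b] by simp
      qed auto
      moreover have "T = ?M \<inter> {X. trace X = trace X0} \<inter> {X. A 0 \<bullet> X = A 0 \<bullet> X0}
          \<inter> (\<Inter>i\<in>{1..m}. {X. bl i \<le> ereal (A i \<bullet> X)} \<inter> {X. ereal (A i \<bullet> X) \<le> bu i})"
        by (auto simp: T_def S)
      ultimately show ?thesis
        by (simp only:) (intro convex_Int convex_INT convex_majorized_set[OF f(2)] convex_hyperplane)
    qed
    moreover have "X0 \<in> T" using X0 by (simp add: T_def)
    ultimately obtain X where X: "X extreme_point_of T"
      using extreme_point_exists_convex[of T] by blast
    then have XT: "X \<in> S" "trace X = trace X0" "A 0 \<bullet> X = A 0 \<bullet> X0"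
      by (simp_all add: extreme_point_of_def T_def)
    have "int (rank X) \<le> ?bound"
    proof (rule ccontr)
      assume "\<not> ?thesis"
      then obtain \<Delta> where \<Delta>: "\<Delta> \<noteq> 0" "trace \<Delta> = 0" "X + \<Delta> \<in> S" "X - \<Delta> \<in> S"
        using direction[OF XT(1)] by (meson not_le)
      have "A 0 \<bullet> \<Delta> = 0"
        using lower[OF \<Delta>(3)] lower[OF \<Delta>(4)] XT(3) by (simp add: inner_add_right inner_diff_right)
      then have "X + \<Delta> \<in> T" "X - \<Delta> \<in> T"
        using \<Delta> XT by (simp_all add: T_def trace_add trace_sub inner_add_right inner_diff_right)
      then show False using not_extreme_point_if_two_sided[OF \<Delta>(1)] X by blast
    qed
    moreover have "optimal_solution (\<lambda>X. A 0 \<bullet> X) S X"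
      using XT lower by (simp add: optimal_solution_def)
    ultimately show "\<exists>X. optimal_solution (\<lambda>X. A 0 \<bullet> X) S X \<and> int (rank X) \<le> ?bound" by blast
  qed
qed

end
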